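(* Let $X$ be an infinite-dimensional complex Banach space, let $T$ be a bounded linear operator on $X$, and let $\varepsilon>0$. Then there exists a bounded linear operator $F$ on $X$ of rank at most one with $\|F\|<\varepsilon$ such that $T-F$ has an invariant half-space, i.e. there is a closed subspace $L\subset X$ of infinite dimension and infinite codimension with $(T-F)L\subset L$.
   Context: A half-space of a Banach space $X$ is a closed subspace of $X$ that has infinite dimension and infinite codimension. *)

theory Defs
  imports "HOL-Analysis.Analysis"
begin

class cvector = real_vector +
  fixes scaleC :: "complex \<Rightarrow> 'a \<Rightarrow> 'a" (infixr "*\<^sub>C" 75)
  assumes scaleC_add_right: "a *\<^sub>C (x + y) = a *\<^sub>C x + a *\<^sub>C y"
    and scaleC_add_left: "(a + b) *\<^sub>C x = a *\<^sub>C x + b *\<^sub>C x"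
    and scaleC_scaleC: "a *\<^sub>C (b *\<^sub>C x) = (a * b) *\<^sub>C x"
    and scaleC_one: "1 *\<^sub>C x = x"
    and scaleR_scaleC: "r *\<^sub>R x = complex_of_real r *\<^sub>C x"

class cnormed_vector = cvector + real_normed_vector +
  assumes norm_scaleC: "norm (a *\<^sub>C x) = cmod a * norm x"

class cbanach = cnormed_vector + banach

definition clinear :: "('a::cvector \<Rightarrow> 'b::cvector) \<Rightarrow> bool" where
  "clinear f \<longleftrightarrow> (\<forall>x y. f (x + y) = f x + f y) \<and> (\<forall>c x. f (c *\<^sub>C x) = c *\<^sub>C f x)"

definition bounded_clinear :: "('a::cnormed_vector \<Rightarrow> 'b::cnormed_vector) \<Rightarrow> bool" where
  "bounded_clinear f \<longleftrightarrow> clinear f \<and> (\<exists>K. \<forall>x. norm (f x) \<le> norm x * K)"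

definition csubspace :: "'a::cvector set \<Rightarrow> bool" where
  "csubspace L \<longleftrightarrow> 0 \<in> L \<and> (\<forall>x\<in>L. \<forall>y\<in>L. x + y \<in> L) \<and> (\<forall>c. \<forall>x\<in>L. c *\<^sub>C x \<in> L)"

definition cspan :: "'a::cvector set \<Rightarrow> 'a set" where
  "cspan S = {(\<Sum>a\<in>T. c a *\<^sub>C a) | T c. finite T \<and> T \<subseteq> S}"

definition cfinite_dim :: "'a::cvector set \<Rightarrow> bool" where
  "cfinite_dim L \<longleftrightarrow> (\<exists>S. finite S \<and> L \<subseteq> cspan S)"

definition cfinite_codim :: "'a::cvector set \<Rightarrow> bool" where
  "cfinite_codim L \<longleftrightarrow> (\<exists>S. finite S \<and> UNIV \<subseteq> {l + v | l v. l \<in> L \<and> v \<in> cspan S})"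

definition half_space :: "'a::cnormed_vector set \<Rightarrow> bool" where
  "half_space L \<longleftrightarrow> csubspace L \<and> closed L \<and> \<not> cfinite_dim L \<and> \<not> cfinite_codim L"

definition rank_le_one :: "('a::cvector \<Rightarrow> 'b::cvector) \<Rightarrow> bool" where
  "rank_le_one F \<longleftrightarrow> (\<exists>y. range F \<subseteq> cspan {y})"

end

(* Let R be the resolvent of T. If f (R mu e) = 1, then R mu e is an eigenvector of T - f (x) e for mu, and
   f o R mu is an eigenvector of its adjoint; so infinitely many solutions mu, for one pair (e, f) of small
   norm, yield an invariant half-space: the common kernel of half of the functionals, which contains the
   eigenvectors of the other half. If every small pair has only finitely many solutions, Baire's theorem in the space of pairs
   gives, at each boundary point l of the spectrum, a ball of pairs around some (e0, f0) without solutions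
   near l. This bounds the resolvent by Phi = f0 (R e0) - 1 near l and makes 1 / Phi^2, extended by 0, holomorphic
   at l; hence l is an isolated singularity of R, and a pole. Then the spectrum consists of finitely many
   poles, a polynomial in T vanishes by Liouville's theorem, T has an infinite-dimensional eigenspace,
   and no perturbation is needed. *)
theory Submission
  imports Defs "HOL-Complex_Analysis.Complex_Analysis"
begin

section \<open>Infinite dimension and codimension\<close>

text \<open>Nothing is known in advance about the spectrum: it may have interior, or no isolated
  point. So \<open>1 / \<Phi>\<close> cannot be extended across a single puncture; it is continued
  by 0 over all spectral points near \<open>l\<close> at once. The resolvent bound gives only a
  Lipschitz estimate there, and squaring turns it into a vanishing derivative. Isolation of
  \<open>l\<close> then comes from the isolation of zeros of a nonconstant holomorphic function. The
  bound needs a whole ball of pairs: one pair without solutions says nothing about the norm of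
  \<open>R \<mu>\<close>, whereas moving both entries controls all vectors. Finiteness for small
  pairs enters twice: it keeps the solutions of each pair away from \<open>l\<close>, and it
  isolates a solution so that it survives a perturbation of the pair, which makes the sets in
  Baire's theorem closed. Boundary points suffice, because the interior of the spectrum turns out to
  be closed as well, hence empty. Functionals are carried as real ones,
  \<open>'a \<Rightarrow>\<^sub>L real\<close>, so that the pairs form a complete normed
  type.\<close>

interpretation cvec: vector_space "scaleC :: complex \<Rightarrow> 'a::cvector \<Rightarrow> 'a"
  by unfold_locales (auto simp: scaleC_add_right scaleC_add_left scaleC_scaleC scaleC_one)

lemma cspan_eq_span: "cspan S = cvec.span S"
  unfolding cspan_def cvec.span_explicit by auto

lemma csubspace_eq_subspace: "csubspace L = cvec.subspace L"
  unfolding csubspace_def cvec.subspace_def by auto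

lemma not_cfinite_dim_independent:
  assumes "cvec.independent B" "infinite B" "B \<subseteq> L"
  shows "\<not> cfinite_dim L"
  using assms cvec.independent_span_bound unfolding cfinite_dim_def cspan_eq_span by blast

text \<open>Linearity is kept apart from continuity, which is added as \<open>bounded_linear\<close>
  where closed kernels or limits are at stake.\<close>

definition cform :: "('a::cvector \<Rightarrow> complex) \<Rightarrow> bool" where
  "cform f \<longleftrightarrow> (\<forall>x y. f (x + y) = f x + f y) \<and> (\<forall>c x. f (c *\<^sub>C x) = c * f x)"

lemma cform_zero: "cform f \<Longrightarrow> f 0 = 0"
  unfolding cform_def by (metis cvec.scale_zero_left mult_zero_left)

lemma cform_diff: "cform f \<Longrightarrow> f (x - y) = f x - f y"
  unfolding cform_def by (metis add_diff_cancel diff_add_cancel)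

lemma subspace_cform_kernel: "cform f \<Longrightarrow> cvec.subspace {x. f x = 0}"
  by (auto simp: cvec.subspace_def cform_zero) (auto simp: cform_def)

text \<open>A triangular matrix with nonzero diagonal certifies independence: \<open>l i\<close>
  kills all vectors on one side of \<open>x i\<close>, but not \<open>x i\<close>. Both orientations
  occur later, one on the side of the vectors and one on the side of the functionals.\<close>

lemma triangular_not_cfinite_dim:
  fixes l :: "nat \<Rightarrow> 'a::cvector \<Rightarrow> complex" and x :: "nat \<Rightarrow> 'a"
  assumes l: "\<And>i. cform (l i)" and diag: "\<And>i. l i (x i) \<noteq> 0"
    and tri: "(\<forall>i j. i < j \<longrightarrow> l i (x j) = 0) \<or> (\<forall>i j. j < i \<longrightarrow> l i (x j) = 0)"
    and M: "range x \<subseteq> M"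
  shows "\<not> cfinite_dim M"
proof -
  have notin: "x i \<notin> cvec.span (x ` A)" if "\<And>j. j \<in> A \<Longrightarrow> l i (x j) = 0" for i A
  proof
    assume "x i \<in> cvec.span (x ` A)"
    moreover have "cvec.span (x ` A) \<subseteq> {y. l i y = 0}"
      using that by (intro cvec.span_minimal subspace_cform_kernel l) auto
    ultimately show False using diag by auto
  qed
  have "cvec.independent (x ` A)" if "finite A" for A
    using tri
  proof
    \<comment> \<open>Indices enter in decreasing order, so the functional of the new index kills
      every vector already present; the other case runs upwards.\<close>
    assume t: "\<forall>i j. i < j \<longrightarrow> l i (x j) = 0"
    show ?thesis using that
      by (induction A rule: finite_linorder_min_induct)
        (auto simp: cvec.independent_insert notin t cvec.independent_empty)
  next
    assume t: "\<forall>i j. j < i \<longrightarrow> l i (x j) = 0"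
    show ?thesis using that
      by (induction A rule: finite_linorder_max_induct)
        (auto simp: cvec.independent_insert notin t cvec.independent_empty)
  qed
  then have fin: "cvec.independent B" if "finite B" "B \<subseteq> range x" for B
    using that by (metis finite_subset_image)
  have indep: "cvec.independent (range x)"
  proof
    assume "cvec.dependent (range x)"
    then obtain B where "finite B" "B \<subseteq> range x" "cvec.dependent B"
      unfolding cvec.dependent_explicit by blast
    with fin show False by blast
  qed
  have "inj x"
  proof (rule linorder_injI)
    fix i j :: nat assume "i < j"
    with tri diag show "x i \<noteq> x j" by metis
  qed
  then have "infinite (range x)" by (simp add: finite_image_iff)
  with indep M show ?thesis by (intro not_cfinite_dim_independent)
qed

text \<open>The functionals do not see \<open>L\<close>, so each \<open>x j\<close> may be replaced
  by its component in a finite-dimensional complement; the same triangular matrix then contradicts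
  the finite dimension.\<close>

lemma triangular_not_cfinite_codim:
  fixes l :: "nat \<Rightarrow> 'a::cvector \<Rightarrow> complex" and x :: "nat \<Rightarrow> 'a"
  assumes l: "\<And>i. cform (l i)" and diag: "\<And>i. l i (x i) \<noteq> 0"
    and tri: "(\<forall>i j. i < j \<longrightarrow> l i (x j) = 0) \<or> (\<forall>i j. j < i \<longrightarrow> l i (x j) = 0)"
    and L: "\<And>i y. y \<in> L \<Longrightarrow> l i y = 0"
  shows "\<not> cfinite_codim L"
proof
  assume "cfinite_codim L"
  then obtain S where S: "finite S" and *: "UNIV \<subseteq> {y + v |y v. y \<in> L \<and> v \<in> cspan S}"
    unfolding cfinite_codim_def by blast
  have "\<exists>v. v \<in> cspan S \<and> x j - v \<in> L" for j
  proof -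
    have "x j \<in> {y + v |y v. y \<in> L \<and> v \<in> cspan S}" using * by blast
    then show ?thesis by auto
  qed
  then obtain v where v: "\<And>j. v j \<in> cspan S" "\<And>j. x j - v j \<in> L" by metis
  have eq: "l i (v j) = l i (x j)" for i j
    using L[OF v(2)[of j], of i] cform_diff[OF l, of i] by simp
  have "\<not> cfinite_dim (cspan S)"
    by (rule triangular_not_cfinite_dim[of l v]) (use l diag tri v eq in auto)
  with S show False unfolding cfinite_dim_def by blast
qed

text \<open>A hyperplane costs at most one dimension: a single vector off the kernel makes up for
  it. The second conclusion allows iteration.\<close>

lemma not_cfinite_dim_kernel:
  fixes M :: "'a::cvector set"
  assumes M: "\<not> cfinite_dim M" "csubspace M" and f: "cform f"
  shows "\<not> cfinite_dim (M \<inter> {x. f x = 0})" "csubspace (M \<inter> {x. f x = 0})"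
proof -
  show "csubspace (M \<inter> {x. f x = 0})"
    using M subspace_cform_kernel[OF f] by (simp add: csubspace_eq_subspace cvec.subspace_inter)
  show "\<not> cfinite_dim (M \<inter> {x. f x = 0})"
  proof
    assume "cfinite_dim (M \<inter> {x. f x = 0})"
    then obtain S where S: "finite S" "M \<inter> {x. f x = 0} \<subseteq> cvec.span S"
      unfolding cfinite_dim_def cspan_eq_span by blast
    show False
    proof (cases "\<exists>x0\<in>M. f x0 \<noteq> 0")
      case False
      with S have "M \<subseteq> cvec.span S" by auto
      with S M show False unfolding cfinite_dim_def cspan_eq_span by blast
    next
      case True
      then obtain x0 where x0: "x0 \<in> M" "f x0 \<noteq> 0" by blast
      have "M \<subseteq> cvec.span (insert x0 S)"
      proof
        fix x assume x: "x \<in> M"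
        let ?c = "f x / f x0"
        have "f (?c *\<^sub>C x0) = f x" using f x0 by (simp add: cform_def)
        then have "f (x - ?c *\<^sub>C x0) = 0" using cform_diff[OF f] by simp
        moreover have "x - ?c *\<^sub>C x0 \<in> M"
          using x x0 M cvec.subspace_diff cvec.subspace_scale by (metis csubspace_eq_subspace)
        ultimately have "x - ?c *\<^sub>C x0 \<in> cvec.span S" using S by blast
        then show "x \<in> cvec.span (insert x0 S)" using cvec.span_breakdown_eq by blast
      qed
      with S M show False unfolding cfinite_dim_def cspan_eq_span by (meson finite_insert)
    qed
  qed
qed

text \<open>Rank and nullity: preimages of a basis of the image, together with a spanning set of the
  kernel, span \<open>M\<close>. Used contrapositively, to keep images infinite-dimensional.\<close>

lemma cfinite_dim_kernel_image:
  fixes A :: "'a::cvector \<Rightarrow> 'a"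
  assumes A: "clinear A" and M: "csubspace M"
    and ker: "cfinite_dim {x. A x = 0}" and im: "cfinite_dim (A ` M)"
  shows "cfinite_dim M"
proof -
  interpret A: Vector_Spaces.linear "scaleC" "scaleC" A
    using A by unfold_locales (auto simp: clinear_def)
  obtain K where K: "finite K" "{x. A x = 0} \<subseteq> cvec.span K"
    using ker unfolding cfinite_dim_def cspan_eq_span by blast
  obtain S where S: "finite S" "A ` M \<subseteq> cvec.span S"
    using im unfolding cfinite_dim_def cspan_eq_span by blast
  obtain B where B: "B \<subseteq> A ` M" "cvec.independent B" "A ` M \<subseteq> cvec.span B"
    using cvec.maximal_independent_subset by blast
  have "finite B" using cvec.independent_span_bound[OF S(1) B(2)] B(1) S(2) by auto
  then obtain D where D: "D \<subseteq> M" "finite D" "B = A ` D"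
    using B(1) by (meson finite_subset_image)
  have "M \<subseteq> cvec.span (D \<union> K)"
  proof
    fix x assume "x \<in> M"
    then have "A x \<in> cvec.span (A ` D)" using B D by blast
    then obtain y where y: "y \<in> cvec.span D" "A x = A y"
      using A.span_image by auto
    then have "x - y \<in> cvec.span K" using K by (auto simp: A.diff)
    with y have "y + (x - y) \<in> cvec.span (D \<union> K)"
      by (intro cvec.span_add) (meson Un_upper1 Un_upper2 cvec.span_mono subsetD)+
    then show "x \<in> cvec.span (D \<union> K)" by simp
  qed
  with D K show ?thesis unfolding cfinite_dim_def cspan_eq_span by (meson finite_UnI)
qed

section \<open>The Hahn--Banach theorem\<close>

text \<open>The infimum of \<open>p (z + t y) - t p y\<close> over \<open>t \<ge> 0\<close> is again sublinear, lies below \<open>p\<close>, and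
  takes a value at most \<open>- p y\<close> at \<open>- y\<close>; hence a minimal sublinear functional is odd, that is, linear.\<close>

definition sublin :: "('a::real_vector \<Rightarrow> real) \<Rightarrow> bool" where
  "sublin p \<longleftrightarrow> (\<forall>x y. p (x + y) \<le> p x + p y) \<and> (\<forall>r x. 0 \<le> r \<longrightarrow> p (r *\<^sub>R x) = r * p x)"

lemma sublinD: "sublin p \<Longrightarrow> p (x + y) \<le> p x + p y" "sublin p \<Longrightarrow> 0 \<le> r \<Longrightarrow> p (r *\<^sub>R x) = r * p x"
  by (auto simp: sublin_def)

lemma sublin_neg_le: "sublin p \<Longrightarrow> - p (- x) \<le> p x"
  using sublinD(1)[of p x "-x"] sublinD(2)[of p 0 0] by simp

lemma sublin_tilt:
  assumes p: "sublin p"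
  obtains q where "sublin q" "\<And>z. q z \<le> p z" "q (- y) \<le> - p y"
proof
  define g where "g z t = p (z + t *\<^sub>R y) - t * p y" for z t
  define q where "q z = (INF t\<in>{0..}. g z t)" for z
  have lb: "- p (- z) \<le> g z t" if "0 \<le> t" for z t
    using sublinD(1)[OF p, of "z + t *\<^sub>R y" "- z"] sublinD(2)[OF p that, of y] by (simp add: g_def)
  have bdd: "bdd_below (g z ` {0..})" for z
    using lb by (intro bdd_belowI2[of _ "- p (- z)"]) auto
  have le: "q z \<le> g z t" if "0 \<le> t" for z t
    unfolding q_def using that by (intro cINF_lower bdd) auto
  show "q z \<le> p z" for z using le[of 0 z] by (simp add: g_def)
  have p0: "p 0 = 0" using sublinD(2)[OF p, of 0 0] by simp
  show "q (- y) \<le> - p y" using le[of 1 "- y"] by (simp add: g_def p0)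
  have q_ge: "c \<le> q z" if "\<And>t. 0 \<le> t \<Longrightarrow> c \<le> g z t" for c z
    unfolding q_def using that by (intro cINF_greatest) auto
  have q0: "q 0 = 0"
  proof (rule antisym)
    show "q 0 \<le> 0" using le[of 0 0] by (simp add: g_def p0)
    show "0 \<le> q 0" by (rule q_ge) (simp add: g_def sublinD(2)[OF p])
  qed
  have add: "q (z + w) \<le> q z + q w" for z w
  proof -
    have *: "q (z + w) - g w t \<le> q z" if t: "0 \<le> t" for t
    proof (rule q_ge)
      fix s :: real assume s: "0 \<le> s"
      have "q (z + w) \<le> g (z + w) (s + t)" using s t by (intro le) auto
      also have "\<dots> \<le> g z s + g w t"
        using sublinD(1)[OF p, of "z + s *\<^sub>R y" "w + t *\<^sub>R y"]
        by (simp add: g_def algebra_simps)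
      finally show "q (z + w) - g w t \<le> g z s" by simp
    qed
    have "q (z + w) - q z \<le> q w" by (rule q_ge) (use * in force)
    then show ?thesis by simp
  qed
  have scale_le: "q (r *\<^sub>R z) \<le> r * q z" if r: "0 < r" for r z
  proof -
    have "q (r *\<^sub>R z) / r \<le> q z"
    proof (rule q_ge)
      fix t :: real assume t: "0 \<le> t"
      have "q (r *\<^sub>R z) \<le> g (r *\<^sub>R z) (r * t)" using r t by (intro le) auto
      also have "\<dots> = r * g z t"
        using sublinD(2)[OF p, of r "z + t *\<^sub>R y"] r by (simp add: g_def algebra_simps)
      finally show "q (r *\<^sub>R z) / r \<le> g z t" using r by (simp add: field_simps)
    qed
    with r show ?thesis by (simp add: field_simps)
  qed
  have scale: "q (r *\<^sub>R z) = r * q z" if "0 \<le> r" for r z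
  proof (cases "r = 0")
    case False
    with that have r: "0 < r" by simp
    have "q z \<le> q (r *\<^sub>R z) / r" using scale_le[of "1 / r" "r *\<^sub>R z"] r by (simp add: field_simps)
    with r scale_le[OF r, of z] show ?thesis by (simp add: field_simps)
  qed (use q0 in simp)
  show "sublin q" unfolding sublin_def using add scale by blast
qed

text \<open>Zorn's lemma in the reversed pointwise order. A chain is bounded by its pointwise
  infimum, which is finite because every sublinear \<open>q\<close> below \<open>p\<close> satisfies
  - p (- z) <= q z.\<close>

lemma minimal_sublin_below:
  assumes p: "sublin p"
  obtains m where "sublin m" "\<And>z. m z \<le> p z" "\<And>q. sublin q \<Longrightarrow> (\<And>z. q z \<le> m z) \<Longrightarrow> q = m"
proof -
  let ?A = "{q. sublin q \<and> q \<le> p}"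
  have "\<exists>m\<in>?A. \<forall>a\<in>?A. a \<le> m \<longrightarrow> a = m"
  proof (rule predicate_Zorn[of ?A "\<lambda>x y. y \<le> x"])
    show "partial_order_on ?A (relation_of (\<lambda>x y. y \<le> x) ?A)"
      by (auto simp: partial_order_on_def preorder_on_def refl_on_def trans_def antisym_def
          relation_of_def)
  next
    fix C assume C: "C \<in> Chains (relation_of (\<lambda>x y. y \<le> x) ?A)"
    show "\<exists>u\<in>?A. \<forall>a\<in>C. u \<le> a"
    proof (cases "C = {}")
      case True
      with p show ?thesis by auto
    next
      case False
      have C_sub: "sublin q" "q \<le> p" if "q \<in> C" for q
        using C that by (auto simp: Chains_def relation_of_def)
      have C_tot: "a \<le> b \<or> b \<le> a" if "a \<in> C" "b \<in> C" for a b
        using C that by (auto simp: Chains_def relation_of_def)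
      define u where "u z = (INF q\<in>C. q z)" for z
      have "- p (- z) \<le> q z" if "q \<in> C" for q z
        using sublin_neg_le[OF C_sub(1)[OF that], of z] le_funD[OF C_sub(2)[OF that], of "- z"] by linarith
      then have bdd: "bdd_below ((\<lambda>q. q z) ` C)" for z
        by (intro bdd_belowI2[of _ "- p (- z)"])
      have le: "u z \<le> q z" if "q \<in> C" for q z
        unfolding u_def using that bdd by (intro cINF_lower)
      have ge: "c \<le> u z" if "\<And>q. q \<in> C \<Longrightarrow> c \<le> q z" for c z
        unfolding u_def using that False by (intro cINF_greatest)
      have "u (x + y) \<le> u x + u y" for x y
      proof -
        have *: "u (x + y) \<le> a x + b y" if "a \<in> C" "b \<in> C" for a b
        proof -
          \<comment> \<open>Here the chain matters: one member lies below both, so a single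
            functional serves \<open>x\<close> and \<open>y\<close>.\<close>
          have "\<exists>c\<in>C. c \<le> a \<and> c \<le> b" using C_tot[of a b] that by auto
          then obtain c where c: "c \<in> C" "c \<le> a" "c \<le> b" by blast
          have "u (x + y) \<le> c x + c y" using le[OF c(1)] sublinD(1)[OF C_sub(1)[OF c(1)]] order_trans by blast
          also have "\<dots> \<le> a x + b y" using c by (intro add_mono) (auto simp: le_fun_def)
          finally show ?thesis .
        qed
        have "u (x + y) - b y \<le> u x" if "b \<in> C" for b
          by (rule ge) (use * that in force)
        then have "u (x + y) - u x \<le> u y" by (intro ge) force
        then show ?thesis by simp
      qed
      moreover have "u (r *\<^sub>R x) = r * u x" if r: "0 \<le> r" for r x
      proof -
        have "(\<lambda>q. q (r *\<^sub>R x)) ` C = (\<lambda>q. r * q x) ` C"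
          using sublinD(2)[OF C_sub(1) r] by (intro image_cong) auto
        then have "u (r *\<^sub>R x) = (INF q\<in>C. r * q x)" unfolding u_def by simp
        also have "\<dots> = r * u x"
        proof (cases "r = 0")
          case True
          then show ?thesis using False by simp
        next
          case False
          then have rp: "0 < r" using r by simp
          show ?thesis
          proof (rule antisym)
            have bb: "bdd_below ((\<lambda>q. r * q x) ` C)"
              using rp le by (intro bdd_belowI2[of _ "r * u x"]) auto
            have "(INF q\<in>C. r * q x) / r \<le> u x"
              by (rule ge) (use rp cINF_lower[OF bb] in \<open>auto simp: field_simps\<close>)
            then show "(INF q\<in>C. r * q x) \<le> r * u x" using rp by (simp add: field_simps)
            show "r * u x \<le> (INF q\<in>C. r * q x)"
              using rp le \<open>C \<noteq> {}\<close> by (intro cINF_greatest) auto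
          qed
        qed
        finally show ?thesis .
      qed
      ultimately have "sublin u" unfolding sublin_def by blast
      moreover have "u \<le> p" using le False C_sub(2) by (fastforce simp: le_fun_def intro: order_trans)
      moreover have "\<forall>a\<in>C. u \<le> a" using le by (auto simp: le_fun_def)
      ultimately show ?thesis by blast
    qed
  qed
  then obtain m where m: "sublin m" "m \<le> p" "\<And>a. sublin a \<Longrightarrow> a \<le> p \<Longrightarrow> a \<le> m \<Longrightarrow> a = m"
    by blast
  show ?thesis
  proof (rule that[of m])
    show "sublin m" by fact
    show "m z \<le> p z" for z using m(2) by (simp add: le_fun_def)
    show "q = m" if "sublin q" "\<And>z. q z \<le> m z" for q
      using m(2) that by (intro m(3)) (auto simp: le_fun_def intro: order_trans)
  qed
qed

text \<open>The norm is tilted at \<open>x\<close> before minimizing, since an upper bound at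
  \<open>- x\<close> survives the passage to smaller functionals; oddness of the minimal one turns
  it into the lower bound norm x at \<open>x\<close>.\<close>

theorem Hahn_Banach_norming:
  fixes x :: "'a::real_normed_vector"
  obtains f :: "'a \<Rightarrow>\<^sub>L real" where "norm f \<le> 1" "blinfun_apply f x = norm x"
proof -
  have "sublin (norm :: 'a \<Rightarrow> real)" by (simp add: sublin_def norm_triangle_ineq)
  then obtain q where q: "sublin q" "\<And>z. q z \<le> norm z" "q (- x) \<le> - norm x"
    by (rule sublin_tilt[of norm x]) blast
  obtain m where m: "sublin m" "\<And>z. m z \<le> q z"
    and min: "\<And>q'. sublin q' \<Longrightarrow> (\<And>z. q' z \<le> m z) \<Longrightarrow> q' = m"
    by (rule minimal_sublin_below[OF q(1)]) blast
  have odd: "m (- y) = - m y" for y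
  proof -
    obtain q' where "sublin q'" "\<And>z. q' z \<le> m z" "q' (- y) \<le> - m y"
      using sublin_tilt[OF m(1), of y] by blast
    with min[of q'] have "m (- y) \<le> - m y" by auto
    with sublin_neg_le[OF m(1), of "- y"] show ?thesis by simp
  qed
  have add: "m (y + z) = m y + m z" for y z
    using sublinD(1)[OF m(1), of y z] sublinD(1)[OF m(1), of "- y" "- z"] odd[of y] odd[of z] odd[of "y + z"]
    by simp
  have scale: "m (r *\<^sub>R y) = r *\<^sub>R m y" for r y
  proof (cases "0 \<le> r")
    case True
    then show ?thesis using sublinD(2)[OF m(1)] by simp
  next
    case False
    then have "m ((- r) *\<^sub>R y) = (- r) * m y" using sublinD(2)[OF m(1), of "- r" y] by simp
    then show ?thesis using odd[of "r *\<^sub>R y"] by simp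
  qed
  have le: "m z \<le> norm z" for z using m(2) q(2) order_trans by blast
  have abs_le: "\<bar>m z\<bar> \<le> norm z" for z using le[of z] le[of "- z"] odd[of z] by simp
  have bl: "bounded_linear m"
    using add scale abs_le by (intro bounded_linear_intro[of m 1]) auto
  define f where "f = Blinfun m"
  have f: "blinfun_apply f = m" unfolding f_def by (simp add: bounded_linear_Blinfun_apply bl)
  show ?thesis
  proof
    show "norm f \<le> 1" using abs_le by (intro norm_blinfun_bound) (auto simp: f)
    have "m (- x) \<le> - norm x" using m(2) q(3) order_trans by blast
    then show "blinfun_apply f x = norm x" using le[of x] odd[of x] by (simp add: f)
  qed
qed

section \<open>Complex functionals\<close>

lemma bounded_clinear_imp_bounded_linear:
  assumes "bounded_clinear f" shows "bounded_linear f"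
  using assms unfolding bounded_clinear_def clinear_def
  by (auto simp: scaleR_scaleC intro: bounded_linear_intro)

lemma bounded_clinearI:
  assumes "\<And>x y. f (x + y) = f x + f y" "\<And>c x. f (c *\<^sub>C x) = c *\<^sub>C f x"
    "\<And>x. norm (f x) \<le> norm x * K"
  shows "bounded_clinear f"
  using assms unfolding bounded_clinear_def clinear_def by blast

lemma bounded_clinear_add: "bounded_clinear f \<Longrightarrow> f (x + y) = f x + f y"
  and bounded_clinear_scaleC: "bounded_clinear f \<Longrightarrow> f (c *\<^sub>C x) = c *\<^sub>C f x"
  by (auto simp: bounded_clinear_def clinear_def)

lemma bounded_clinear_diff: "bounded_clinear f \<Longrightarrow> f (x - y) = f x - f y"
  by (simp add: bounded_clinear_imp_bounded_linear linear_diff bounded_linear.linear)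

lemma bounded_clinear_compose:
  assumes "bounded_clinear f" "bounded_clinear g"
  shows "bounded_clinear (\<lambda>x. f (g x))"
proof -
  obtain K where "\<And>x. norm (f (g x)) \<le> norm x * K"
    using bounded_linear.bounded[OF bounded_linear_compose[of f g]] assms bounded_clinear_imp_bounded_linear
    by metis
  then show ?thesis
    using assms by (intro bounded_clinearI) (simp_all add: bounded_clinear_add bounded_clinear_scaleC)
qed

lemma bounded_linear_scaleC: "bounded_linear (\<lambda>x::'a::cnormed_vector. c *\<^sub>C x)"
  by (intro bounded_clinear_imp_bounded_linear bounded_clinearI[where K = "cmod c"])
    (simp_all add: scaleC_add_right scaleC_scaleC norm_scaleC mult.commute)

text \<open>The complex-linear functional with real part \<open>f\<close>, that is, f x - i f (i
  x).\<close>

definition complexify :: "('a::cnormed_vector \<Rightarrow>\<^sub>L real) \<Rightarrow> 'a \<Rightarrow> complex" where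
  "complexify f x = Complex (f x) (- f (\<i> *\<^sub>C x))"

lemma cform_complexify: "cform (complexify f)"
proof -
  have add: "complexify f (x + y) = complexify f x + complexify f y" for x y
    by (simp add: complexify_def complex_eq_iff scaleC_add_right blinfun.add_right)
  have "complexify f (Complex a b *\<^sub>C x) = Complex a b * complexify f x" for a b x
  proof -
    have *: "Complex a b *\<^sub>C x = a *\<^sub>R x + b *\<^sub>R (\<i> *\<^sub>C x)" for a b
      by (simp add: scaleR_scaleC scaleC_scaleC Complex_eq mult.commute flip: scaleC_add_left)
    have "\<i> *\<^sub>C (Complex a b *\<^sub>C x) = Complex (- b) a *\<^sub>C x"
      by (simp add: scaleC_scaleC) (simp add: complex_eq_iff)
    then show ?thesis
      by (simp add: complexify_def * complex_eq_iff blinfun.add_right blinfun.scaleR_right blinfun.diff_right)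
  qed
  then have "complexify f (c *\<^sub>C x) = c * complexify f x" for c x
    by (metis complex.exhaust)
  with add show ?thesis by (simp add: cform_def)
qed

text \<open>The crude factor 2 (rotating \<open>x\<close> would give 1) is absorbed by the choice of
  \<open>\<eta>\<close> in the main proof.\<close>

lemma norm_complexify_le: "cmod (complexify f x) \<le> 2 * norm f * norm x"
proof -
  have "cmod (complexify f x) \<le> \<bar>f x\<bar> + \<bar>f (\<i> *\<^sub>C x)\<bar>"
    unfolding complexify_def using cmod_le[of "Complex (f x) (- f (\<i> *\<^sub>C x))"] by simp
  also have "\<dots> \<le> 2 * norm f * norm x"
    using norm_blinfun[of f x] norm_blinfun[of f "\<i> *\<^sub>C x"] by (simp add: norm_scaleC)
  finally show ?thesis .
qed

lemma complexify_add_left: "complexify (f + g) x = complexify f x + complexify g x"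
  by (simp add: complexify_def blinfun.add_left complex_eq_iff)

lemma complexify_diff_left: "complexify (f - g) x = complexify f x - complexify g x"
  by (simp add: complexify_def blinfun.diff_left complex_eq_iff)

lemma bounded_linear_complexify: "bounded_linear (complexify f)"
proof (rule bounded_linear_intro)
  show "norm (complexify f x) \<le> norm x * (2 * norm f)" for x
    using norm_complexify_le[of f x] by (simp add: mult_ac)
  show "complexify f (r *\<^sub>R x) = r *\<^sub>R complexify f x" for r x
    using cform_complexify[of f] by (simp add: scaleR_scaleC cform_def scaleR_conv_of_real)
qed (use cform_complexify[of f] in \<open>simp add: cform_def\<close>)

text \<open>A norming functional has a value \<open>a\<close> at \<open>w\<close> with real part
  norm w, so multiplying by c / a costs at most cmod c / norm w. The complex factor acts on the
  argument, as real functionals have real multiples only.\<close>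

lemma complexify_attains:
  fixes w :: "'a::cnormed_vector"
  assumes w: "w \<noteq> 0"
  obtains g where "norm g \<le> cmod c / norm w" "complexify g w = c"
proof -
  obtain f :: "'a \<Rightarrow>\<^sub>L real" where f: "norm f \<le> 1" "f w = norm w"
    by (rule Hahn_Banach_norming)
  define a where "a = complexify f w"
  have a: "norm w \<le> cmod a"
    using complex_Re_le_cmod[of a] f by (simp add: a_def complexify_def)
  have ball: "bounded_linear (\<lambda>x. f ((c / a) *\<^sub>C x))"
    by (intro bounded_linear_compose[OF blinfun.bounded_linear_right bounded_linear_scaleC])
  define g where "g = Blinfun (\<lambda>x. f ((c / a) *\<^sub>C x))"
  have g: "blinfun_apply g x = f ((c / a) *\<^sub>C x)" for x
    unfolding g_def by (simp add: bounded_linear_Blinfun_apply ball)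
  show ?thesis
  proof
    have "norm g \<le> cmod (c / a)"
    proof (rule norm_blinfun_bound)
      fix x
      have "norm (g x) \<le> norm f * norm ((c / a) *\<^sub>C x)" unfolding g by (rule norm_blinfun)
      also have "\<dots> \<le> 1 * norm ((c / a) *\<^sub>C x)" using f by (intro mult_right_mono) auto
      finally show "norm (g x) \<le> cmod (c / a) * norm x" by (simp add: norm_scaleC)
    qed simp
    also have "\<dots> \<le> cmod c / norm w"
      using a w by (simp add: norm_divide) (intro divide_left_mono mult_pos_pos, auto)
    finally show "norm g \<le> cmod c / norm w" .
    have "complexify g w = complexify f ((c / a) *\<^sub>C w)"
      unfolding complexify_def g by (simp add: scaleC_scaleC mult.commute)
    also have "\<dots> = (c / a) * a" unfolding a_def using cform_complexify[of f] by (simp add: cform_def)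
    also have "\<dots> = c" using a w by auto
    finally show "complexify g w = c" .
  qed
qed

lemma complexify_separates:
  assumes "\<And>f. complexify f x = 0" shows "x = 0"
  using complexify_attains[of x 1] assms by (metis zero_neq_one)

section \<open>The resolvent\<close>

locale bounded_operator =
  fixes T :: "'a::cbanach \<Rightarrow> 'a"
  assumes T: "bounded_clinear T"
begin

definition shift :: "complex \<Rightarrow> 'a \<Rightarrow> 'a" where
  "shift \<mu> x = T x - \<mu> *\<^sub>C x"

lemma bounded_clinear_shift: "bounded_clinear (shift \<mu>)"
proof -
  obtain K where K: "\<And>x. norm (T x) \<le> norm x * K" using T unfolding bounded_clinear_def by blast
  show ?thesis
  proof (rule bounded_clinearI)
    show "shift \<mu> (x + y) = shift \<mu> x + shift \<mu> y" for x y
      by (simp add: shift_def bounded_clinear_add[OF T] scaleC_add_right)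
    show "shift \<mu> (c *\<^sub>C x) = c *\<^sub>C shift \<mu> x" for c x
      by (simp add: shift_def bounded_clinear_scaleC[OF T] scaleC_scaleC mult.commute cvec.scale_right_diff_distrib)
    show "norm (shift \<mu> x) \<le> norm x * (K + cmod \<mu>)" for x
      using norm_triangle_ineq4[of "T x" "\<mu> *\<^sub>C x"] K[of x] by (simp add: shift_def norm_scaleC algebra_simps)
  qed
qed

text \<open>Surjective and bounded below stands for invertible with bounded inverse; injectivity and
  the bound come together, without the open mapping theorem.\<close>

definition resolvent_set :: "complex set" where
  "resolvent_set = {\<mu>. surj (shift \<mu>) \<and> (\<exists>K>0. \<forall>x. norm x \<le> K * norm (shift \<mu> x))}"

definition R :: "complex \<Rightarrow> 'a \<Rightarrow> 'a" where
  "R \<mu> = inv (shift \<mu>)"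

lemma shift_R: "\<mu> \<in> resolvent_set \<Longrightarrow> shift \<mu> (R \<mu> x) = x"
  unfolding resolvent_set_def R_def by (auto intro: surj_f_inv_f)

lemma R_shift:
  assumes "\<mu> \<in> resolvent_set" shows "R \<mu> (shift \<mu> x) = x"
proof -
  obtain K where "\<And>x. norm x \<le> K * norm (shift \<mu> x)" using assms unfolding resolvent_set_def by blast
  from this[of "R \<mu> (shift \<mu> x) - x"] shift_R[OF assms]
  show ?thesis by (simp add: bounded_clinear_diff[OF bounded_clinear_shift])
qed

lemma R_unique: "\<mu> \<in> resolvent_set \<Longrightarrow> shift \<mu> x = y \<Longrightarrow> R \<mu> y = x"
  using R_shift by blast

lemma R_bound:
  assumes "\<mu> \<in> resolvent_set" obtains K where "K > 0" "\<And>x. norm (R \<mu> x) \<le> K * norm x"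
proof -
  obtain K where "K > 0" "\<And>x. norm x \<le> K * norm (shift \<mu> x)" using assms unfolding resolvent_set_def by blast
  with that show ?thesis by (metis shift_R[OF assms])
qed

lemma bounded_clinear_R:
  assumes m: "\<mu> \<in> resolvent_set" shows "bounded_clinear (R \<mu>)"
proof -
  obtain K where K: "\<And>x. norm (R \<mu> x) \<le> K * norm x" using R_bound[OF m] by metis
  show ?thesis
    using K by (intro bounded_clinearI[where K = K] R_unique[OF m])
      (simp_all add: bounded_clinear_add[OF bounded_clinear_shift]
        bounded_clinear_scaleC[OF bounded_clinear_shift] shift_R[OF m] mult.commute)
qed

lemma shift_eq: "shift \<mu> x = shift \<nu> x + (\<nu> - \<mu>) *\<^sub>C x"
  by (simp add: shift_def cvec.scale_left_diff_distrib)

lemma resolvent_identity: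
  assumes "\<mu> \<in> resolvent_set" "\<nu> \<in> resolvent_set"
  shows "R \<mu> x - R \<nu> x = (\<mu> - \<nu>) *\<^sub>C R \<mu> (R \<nu> x)"
proof -
  have "R \<mu> (x + (\<nu> - \<mu>) *\<^sub>C R \<nu> x) = R \<nu> x"
    using assms by (intro R_unique) (simp_all add: shift_eq[of \<mu> _ \<nu>] shift_R)
  then have "R \<mu> x + (\<nu> - \<mu>) *\<^sub>C R \<mu> (R \<nu> x) = R \<nu> x"
    by (simp only: bounded_clinear_add[OF bounded_clinear_R] bounded_clinear_scaleC[OF bounded_clinear_R] assms)
  then show ?thesis
    by (simp add: algebra_simps)
qed

text \<open>The Neumann series, in the form of Banach's fixed point theorem.\<close>

lemma resolvent_set_perturb:
  assumes m: "\<mu> \<in> resolvent_set" and K: "0 < K" "\<And>x. norm (R \<mu> x) \<le> K * norm x"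
    and d: "cmod (\<nu> - \<mu>) * K < 1"
  shows "\<nu> \<in> resolvent_set" "(1 - cmod (\<nu> - \<mu>) * K) * norm (R \<nu> x) \<le> K * norm x"
proof -
  define c where "c = cmod (\<nu> - \<mu>) * K"
  have c: "0 \<le> c" "c < 1" using K d by (auto simp: c_def)
  have surj: "\<exists>x. shift \<nu> x = y" for y
  proof -
    have "\<exists>!x. R \<mu> (y + (\<nu> - \<mu>) *\<^sub>C x) = x"
    proof (rule banach_fix_type[OF c], intro allI)
      fix x x'
      have "R \<mu> (y + (\<nu> - \<mu>) *\<^sub>C x) - R \<mu> (y + (\<nu> - \<mu>) *\<^sub>C x') = (\<nu> - \<mu>) *\<^sub>C R \<mu> (x - x')"
        by (simp flip: bounded_clinear_diff[OF bounded_clinear_R[OF m]] bounded_clinear_scaleC[OF bounded_clinear_R[OF m]]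
            add: cvec.scale_right_diff_distrib)
      then show "dist (R \<mu> (y + (\<nu> - \<mu>) *\<^sub>C x)) (R \<mu> (y + (\<nu> - \<mu>) *\<^sub>C x')) \<le> c * dist x x'"
        using mult_left_mono[OF K(2)[of "x - x'"], of "cmod (\<nu> - \<mu>)"]
        by (simp add: dist_norm norm_scaleC c_def mult_ac)
    qed
    then obtain x where "R \<mu> (y + (\<nu> - \<mu>) *\<^sub>C x) = x" by blast
    then have "shift \<mu> x = y + (\<nu> - \<mu>) *\<^sub>C x" using shift_R[OF m] by metis
    then show ?thesis using shift_eq[of \<nu> x \<mu>]
      by (intro exI[of _ x]) (simp add: cvec.scale_left_diff_distrib)
  qed
  have bound: "(1 - c) * norm x \<le> K * norm (shift \<nu> x)" for x
  proof -
    have "x = R \<mu> (shift \<nu> x + (\<nu> - \<mu>) *\<^sub>C x)"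
      using R_unique[OF m, of x] shift_eq[of \<mu> x \<nu>] by metis
    then have "norm x \<le> K * norm (shift \<nu> x + (\<nu> - \<mu>) *\<^sub>C x)" by (metis K(2))
    also have "\<dots> \<le> K * (norm (shift \<nu> x) + cmod (\<nu> - \<mu>) * norm x)"
      using K norm_triangle_ineq[of "shift \<nu> x" "(\<nu> - \<mu>) *\<^sub>C x"] by (intro mult_left_mono) (auto simp: norm_scaleC)
    finally show ?thesis by (simp add: c_def algebra_simps)
  qed
  have "norm x \<le> K / (1 - c) * norm (shift \<nu> x)" for x
    using bound[of x] c by (simp add: field_simps)
  moreover have "0 < K / (1 - c)" using K c by simp
  ultimately show n: "\<nu> \<in> resolvent_set"
    unfolding resolvent_set_def using surj by (auto simp: surj_def) metis
  show "(1 - cmod (\<nu> - \<mu>) * K) * norm (R \<nu> x) \<le> K * norm x"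
    using bound[of "R \<nu> x"] shift_R[OF n] by (simp add: c_def)
qed

lemma resolvent_locally_bounded:
  assumes m: "\<mu> \<in> resolvent_set"
  obtains r K where "0 < r" "0 < K" "cball \<mu> r \<subseteq> resolvent_set"
    "\<And>\<nu> x. \<nu> \<in> cball \<mu> r \<Longrightarrow> norm (R \<nu> x) \<le> K * norm x"
proof -
  obtain K where K: "K > 0" "\<And>x. norm (R \<mu> x) \<le> K * norm x" using R_bound[OF m] by blast
  have *: "cmod (\<nu> - \<mu>) * K \<le> 1 / 2" if "\<nu> \<in> cball \<mu> (1 / (2 * K))" for \<nu>
    using that K by (auto simp: dist_norm norm_minus_commute field_simps)
  show ?thesis
  proof (rule that[of "1 / (2 * K)" "2 * K"])
    fix \<nu> x assume \<nu>: "\<nu> \<in> cball \<mu> (1 / (2 * K))"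
    have "1 / 2 * norm (R \<nu> x) \<le> (1 - cmod (\<nu> - \<mu>) * K) * norm (R \<nu> x)"
      using *[OF \<nu>] by (intro mult_right_mono) auto
    also have "\<dots> \<le> K * norm x" using *[OF \<nu>] by (intro resolvent_set_perturb[OF m K]) auto
    finally show "norm (R \<nu> x) \<le> 2 * K * norm x" by simp
  next
    show "cball \<mu> (1 / (2 * K)) \<subseteq> resolvent_set"
      using * by (intro subsetI resolvent_set_perturb(1)[OF m K]) fastforce
  qed (use K in auto)
qed

lemma open_resolvent_set: "open resolvent_set"
  unfolding open_contains_cball using resolvent_locally_bounded by metis

text \<open>With \<open>B\<close> a bound of \<open>T\<close>, solving for \<open>x\<close> is a
  fixed point problem with contraction ratio B / cmod \<mu>. The last estimate is the decay at
  infinity that Liouville's theorem will use.\<close>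

lemma resolvent_set_large:
  obtains B where "0 < B" "\<And>\<mu>. B < cmod \<mu> \<Longrightarrow> \<mu> \<in> resolvent_set"
    "\<And>\<mu> x. B < cmod \<mu> \<Longrightarrow> (cmod \<mu> - B) * norm (R \<mu> x) \<le> norm x"
proof -
  obtain B where B: "0 < B" "\<And>x. norm (T x) \<le> norm x * B"
    using bounded_linear.pos_bounded[OF bounded_clinear_imp_bounded_linear[OF T]] by blast
  have bound: "(cmod \<mu> - B) * norm x \<le> norm (shift \<mu> x)" for \<mu> x
    using norm_triangle_ineq2[of "\<mu> *\<^sub>C x" "T x"] B(2)[of x]
    by (simp add: shift_def norm_scaleC norm_minus_commute algebra_simps)
  have res: "\<mu> \<in> resolvent_set" if \<mu>: "B < cmod \<mu>" for \<mu>
  proof -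
    have m0: "\<mu> \<noteq> 0" using \<mu> B by auto
    have surj: "\<exists>x. y = shift \<mu> x" for y
    proof -
      have "\<exists>!x. (1 / \<mu>) *\<^sub>C (T x - y) = x"
      proof (rule banach_fix_type[of "B / cmod \<mu>"], goal_cases)
        case 3
        show ?case
        proof (intro allI)
          fix x x'
          have "(1 / \<mu>) *\<^sub>C (T x - y) - (1 / \<mu>) *\<^sub>C (T x' - y) = (1 / \<mu>) *\<^sub>C T (x - x')"
            by (simp add: bounded_clinear_diff[OF T] flip: cvec.scale_right_diff_distrib)
          then show "dist ((1 / \<mu>) *\<^sub>C (T x - y)) ((1 / \<mu>) *\<^sub>C (T x' - y)) \<le> B / cmod \<mu> * dist x x'"
            using B(2)[of "x - x'"] m0 by (simp add: dist_norm norm_scaleC norm_divide field_simps)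
        qed
      qed (use \<mu> B m0 in auto)
      then obtain x where "(1 / \<mu>) *\<^sub>C (T x - y) = x" by blast
      then have "\<mu> *\<^sub>C x = \<mu> *\<^sub>C (1 / \<mu>) *\<^sub>C (T x - y)" by simp
      also have "\<dots> = T x - y" using m0 by (simp add: scaleC_scaleC scaleC_one)
      finally show ?thesis by (intro exI[of _ x]) (simp add: shift_def)
    qed
    have "norm x \<le> 1 / (cmod \<mu> - B) * norm (shift \<mu> x)" for x
      using bound[of \<mu> x] \<mu> by (simp add: field_simps)
    moreover have "0 < 1 / (cmod \<mu> - B)" using \<mu> by simp
    ultimately have "\<exists>K>0. \<forall>x. norm x \<le> K * norm (shift \<mu> x)" by blast
    then show ?thesis
      using surj by (simp add: resolvent_set_def surj_def)
  qed
  show ?thesis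
    using that[OF B(1) res] bound shift_R[OF res] by metis
qed

text \<open>By the resolvent identity the difference quotient is
  \<open>f (R \<nu> (R \<mu> e))\<close>, so pointwise continuity of \<open>R\<close> is enough.
  Only such scalar functions are ever differentiated.\<close>

lemma R_has_field_derivative:
  assumes m: "\<mu> \<in> resolvent_set" and f: "cform f" "bounded_linear f"
  shows "((\<lambda>\<nu>. f (R \<nu> e)) has_field_derivative f (R \<mu> (R \<mu> e))) (at \<mu>)"
proof -
  obtain r K where rK: "0 < r" "0 < K" "cball \<mu> r \<subseteq> resolvent_set"
    and K: "\<And>\<nu> x. \<nu> \<in> cball \<mu> r \<Longrightarrow> norm (R \<nu> x) \<le> K * norm x"
    using resolvent_locally_bounded[OF m] by metis
  have near: "\<forall>\<^sub>F \<nu> in at \<mu>. \<nu> \<in> cball \<mu> r \<and> \<nu> \<noteq> \<mu>"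
    using rK(1) eventually_at[of "\<lambda>\<nu>. \<nu> \<in> cball \<mu> r \<and> \<nu> \<noteq> \<mu>" \<mu> UNIV]
    by (auto simp: dist_commute intro!: exI[of _ r])
  have "((\<lambda>\<nu>. R \<nu> x - R \<mu> x) \<longlongrightarrow> 0) (at \<mu>)" for x
  proof (rule Lim_null_comparison)
    show "\<forall>\<^sub>F \<nu> in at \<mu>. norm (R \<nu> x - R \<mu> x) \<le> cmod (\<nu> - \<mu>) * (K * norm (R \<mu> x))"
      using near
    proof eventually_elim
      case (elim \<nu>)
      then have "R \<nu> x - R \<mu> x = (\<nu> - \<mu>) *\<^sub>C R \<nu> (R \<mu> x)" using rK m by (intro resolvent_identity) auto
      then show ?case using K[of \<nu> "R \<mu> x"] elim by (simp add: norm_scaleC mult_left_mono)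
    qed
    show "((\<lambda>\<nu>. cmod (\<nu> - \<mu>) * (K * norm (R \<mu> x))) \<longlongrightarrow> 0) (at \<mu>)"
      by (auto intro!: tendsto_eq_intros)
  qed
  then have cont: "((\<lambda>\<nu>. R \<nu> x) \<longlongrightarrow> R \<mu> x) (at \<mu>)" for x
    by (simp add: LIM_zero_iff)
  have "((\<lambda>\<nu>. f (R \<nu> (R \<mu> e))) \<longlongrightarrow> f (R \<mu> (R \<mu> e))) (at \<mu>)"
    by (intro bounded_linear.tendsto[OF f(2)] cont)
  moreover have "\<forall>\<^sub>F \<nu> in at \<mu>. f (R \<nu> (R \<mu> e)) = (f (R \<nu> e) - f (R \<mu> e)) / (\<nu> - \<mu>)"
    using near
  proof eventually_elim
    case (elim \<nu>)
    then have "R \<nu> e - R \<mu> e = (\<nu> - \<mu>) *\<^sub>C R \<nu> (R \<mu> e)" using rK m by (intro resolvent_identity) auto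
    then have "f (R \<nu> e) - f (R \<mu> e) = (\<nu> - \<mu>) * f (R \<nu> (R \<mu> e))"
      using f by (metis cform_diff cform_def)
    with elim show ?case by simp
  qed
  ultimately show ?thesis
    unfolding has_field_derivative_iff by (rule Lim_transform_eventually)
qed

end

section \<open>Construction of half-spaces\<close>

lemma closed_cform_kernel:
  "bounded_linear f \<Longrightarrow> closed {x. f x = (0::complex)}"
  by (intro closed_Collect_eq continuous_intros linear_continuous_on)

lemma not_cfinite_dim_nonzero:
  assumes "\<not> cfinite_dim M" shows "\<exists>x\<in>M. x \<noteq> 0"
proof (rule ccontr)
  assume "\<not> ?thesis"
  then have "M \<subseteq> cspan {0}" by (auto simp: cspan_eq_span)
  with assms show False unfolding cfinite_dim_def by blast
qed

text \<open>Each new vector is taken from the common kernel of the earlier functionals, still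
  infinite-dimensional within \<open>K\<close>; this gives a triangular system, which elimination on
  the functionals makes diagonal.\<close>

lemma biorthogonal_sequence:
  fixes K :: "'a::cnormed_vector set"
  assumes K: "\<not> cfinite_dim K" "csubspace K"
  obtains x :: "nat \<Rightarrow> 'a" and b :: "nat \<Rightarrow> 'a \<Rightarrow> complex" where
    "\<And>n. x n \<in> K" "\<And>n. cform (b n)" "\<And>n. bounded_linear (b n)"
    "\<And>m n. b n (x m) = (if m = n then 1 else 0)"
proof -
  have "\<exists>g. x \<noteq> 0 \<longrightarrow> complexify g x = 1" for x :: 'a using complexify_attains by metis
  then obtain \<phi> where \<phi>: "\<And>x::'a. x \<noteq> 0 \<Longrightarrow> complexify (\<phi> x) x = 1" by metis
  have "\<exists>x. \<forall>n::nat. x n \<in> K \<and> x n \<noteq> 0 \<and> (\<forall>m<n. complexify (\<phi> (x m)) (x n) = 0)"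
  proof (rule dependent_wellorder_choice)
    fix n :: nat and x
    have inter: "\<not> cfinite_dim (K \<inter> {y. \<forall>m<k. complexify (\<phi> (x m)) y = 0}) \<and>
        csubspace (K \<inter> {y. \<forall>m<k. complexify (\<phi> (x m)) y = 0})" for k :: nat
    proof (induction k)
      case 0
      then show ?case using K by simp
    next
      case (Suc k)
      have "K \<inter> {y. \<forall>m<Suc k. complexify (\<phi> (x m)) y = 0} =
          (K \<inter> {y. \<forall>m<k. complexify (\<phi> (x m)) y = 0}) \<inter> {y. complexify (\<phi> (x k)) y = 0}"
        by (auto simp: less_Suc_eq)
      then show ?case
        using not_cfinite_dim_kernel[OF conjunct1[OF Suc.IH] conjunct2[OF Suc.IH] cform_complexify] by simp
    qed
    show "\<exists>r. r \<in> K \<and> r \<noteq> 0 \<and> (\<forall>m<n. complexify (\<phi> (x m)) r = 0)"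
      using not_cfinite_dim_nonzero[OF conjunct1[OF inter[of n]]] by auto
  qed simp
  then obtain x where x: "\<And>n::nat. x n \<in> K" "\<And>n. x n \<noteq> 0"
    "\<And>m n. m < n \<Longrightarrow> complexify (\<phi> (x m)) (x n) = 0" by blast
  define f where "f n = complexify (\<phi> (x n))" for n
  have f: "cform (f n)" "bounded_linear (f n)" "f n (x n) = 1" "m < n \<Longrightarrow> f m (x n) = 0" for m n
    by (simp_all add: f_def cform_complexify bounded_linear_complexify \<phi> x)
  \<comment> \<open>Only the values of \<open>f n\<close> at earlier vectors have to be removed; at
    later vectors it vanishes by the choice of the sequence.\<close>
  have "\<exists>b. \<forall>n. b n = (\<lambda>y. f n y - (\<Sum>m<n. f n (x m) * b m y))"
    by (rule dependent_wellorder_choice) auto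
  then obtain b where b: "\<And>n. b n = (\<lambda>y. f n y - (\<Sum>m<n. f n (x m) * b m y))" by blast
  have "cform (b n) \<and> bounded_linear (b n) \<and> (\<forall>m. b n (x m) = (if m = n then 1 else 0))" for n
  proof (induction n rule: less_induct)
    case (less n)
    have "cform (b n)"
      using less.IH f(1)[of n] unfolding b[of n] cform_def
      by (simp add: sum.distrib distrib_left algebra_simps sum_distrib_left)
    moreover have "bounded_linear (b n)"
      unfolding b[of n] using less.IH
      by (intro bounded_linear_sub f bounded_linear_sum bounded_linear_const_mult) auto
    moreover have "b n (x m) = (if m = n then 1 else 0)" for m
    proof -
      have "(\<Sum>k<n. f n (x k) * b k (x m)) = (\<Sum>k<n. if k = m then f n (x m) else 0)"
        using less.IH by (intro sum.cong) auto
      then show ?thesis unfolding b[of n] using f(3,4)[of n] f(4)[of n m]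
        by (cases m n rule: linorder_cases) auto
    qed
    ultimately show ?case by blast
  qed
  with that x show ?thesis by blast
qed

text \<open>The odd functionals cut out \<open>L\<close>: the even vectors stay in it, the odd ones
  are independent modulo it.\<close>

lemma half_space_within:
  fixes K :: "'a::cnormed_vector set"
  assumes K: "\<not> cfinite_dim K" "csubspace K" "closed K"
  obtains L where "half_space L" "L \<subseteq> K"
proof -
  obtain x :: "nat \<Rightarrow> 'a" and b where x: "\<And>n. x n \<in> K"
    and b: "\<And>n. cform (b n)" "\<And>n. bounded_linear (b n)"
      "\<And>m n. b n (x m) = (if m = n then 1 else 0)"
    using biorthogonal_sequence[OF K(1,2)] by metis
  define L where "L = K \<inter> (\<Inter>n. {y. b (2 * n + 1) y = 0})"
  have "half_space L"
    unfolding half_space_def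
  proof (intro conjI)
    show "csubspace L"
      unfolding L_def csubspace_eq_subspace
      using K b by (intro cvec.subspace_inter cvec.subspace_Inter) (auto simp: csubspace_eq_subspace subspace_cform_kernel)
    show "closed L" unfolding L_def using K b by (intro closed_Int closed_INT ballI closed_cform_kernel)
    show "\<not> cfinite_dim L"
      by (rule triangular_not_cfinite_dim[of "\<lambda>n. b (2 * n)" "\<lambda>n. x (2 * n)"])
        (auto simp: b x L_def, presburger)
    show "\<not> cfinite_codim L"
      by (rule triangular_not_cfinite_codim[of "\<lambda>n. b (2 * n + 1)" "\<lambda>n. x (2 * n + 1)"])
        (auto simp: b L_def)
  qed
  with that show ?thesis by (auto simp: L_def)
qed

context bounded_operator
begin

lemma R_commute:
  assumes "\<mu> \<in> resolvent_set" shows "R \<mu> (T x) = x + \<mu> *\<^sub>C R \<mu> x"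
  using R_shift[OF assms, of x]
  by (simp add: shift_def bounded_clinear_diff[OF bounded_clinear_R[OF assms]]
      bounded_clinear_scaleC[OF bounded_clinear_R[OF assms]] algebra_simps)

text \<open>A solution \<open>\<mu>\<close> of \<open>f (R \<mu> e) = 1\<close> makes \<open>R \<mu> e\<close> an eigenvector of \<open>T - f \<otimes> e\<close>, and
  \<open>f \<circ> R \<mu>\<close> an eigenvector of the adjoint. With infinitely many solutions, half of them supply vectors
  of the subspace, and the other half functionals that annihilate it.\<close>

lemma half_space_if_infinitely_many_solutions:
  fixes e f
  defines "F \<equiv> \<lambda>x. complexify f x *\<^sub>C e"
  assumes inf: "infinite {\<mu> \<in> resolvent_set. complexify f (R \<mu> e) = 1}"
  obtains L where "half_space L" "(\<lambda>x. T x - F x) ` L \<subseteq> L"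
proof -
  let ?f = "complexify f"
  obtain s :: "nat \<Rightarrow> complex" where s: "inj s" "range s \<subseteq> {\<mu> \<in> resolvent_set. ?f (R \<mu> e) = 1}"
    using infinite_countable_subset[OF inf] by blast
  \<comment> \<open>The \<open>\<mu> i\<close> will supply the functionals and the
    \<open>\<nu> i\<close> the vectors.\<close>
  define \<mu> \<nu> where "\<mu> i = s (2 * i + 1)" and "\<nu> i = s (2 * i)" for i
  have res: "\<mu> i \<in> resolvent_set" "\<nu> i \<in> resolvent_set" for i using s unfolding \<mu>_def \<nu>_def by auto
  have one: "?f (R (\<mu> i) e) = 1" "?f (R (\<nu> i) e) = 1" for i using s unfolding \<mu>_def \<nu>_def by auto
  have neq: "\<mu> i \<noteq> \<nu> j" "\<mu> i = \<mu> j \<longleftrightarrow> i = j" "\<nu> i = \<nu> j \<longleftrightarrow> i = j" for i j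
    using s(1) by (auto simp: \<mu>_def \<nu>_def inj_eq) presburger
  define G where "G x = T x - F x" for x
  have f_lin: "?f (x + y) = ?f x + ?f y" "?f (x - y) = ?f x - ?f y" "?f (c *\<^sub>C x) = c * ?f x" for x y c
    using cform_complexify[of f] cform_diff[of ?f] by (simp_all add: cform_def)
  define h where "h i = R (\<nu> i) e" for i
  have Gh: "G (h i) = \<nu> i *\<^sub>C h i" for i
    using shift_R[OF res(2)[of i], of e] by (simp add: G_def F_def h_def one scaleC_one shift_def algebra_simps)
  define l where "l i x = ?f (R (\<mu> i) x)" for i x
  have cform_l: "cform (l i)" for i
    by (simp add: cform_def l_def f_lin bounded_clinear_add[OF bounded_clinear_R[OF res(1)]]
        bounded_clinear_scaleC[OF bounded_clinear_R[OF res(1)]])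
  then have l_lin: "l i (x + y) = l i x + l i y" "l i (x - y) = l i x - l i y" "l i (c *\<^sub>C x) = c * l i x" for i x y c
    using cform_diff[of "l i"] by (simp_all add: cform_def)
  have blin_l: "bounded_linear (l i)" for i
    unfolding l_def by (intro bounded_linear_compose[OF bounded_linear_complexify]
        bounded_clinear_imp_bounded_linear bounded_clinear_R res)
  have lG: "l i (G x) = \<mu> i * l i x" for i x
  proof -
    have "l i (T x) = ?f x + \<mu> i * l i x"
      unfolding l_def R_commute[OF res(1)] by (simp add: f_lin)
    moreover have "l i (F x) = ?f x" by (simp add: F_def l_lin) (simp add: l_def one)
    ultimately show ?thesis by (simp add: G_def l_lin)
  qed
  \<comment> \<open>Eigenvectors of an operator and of its adjoint for different eigenvalues
    annihilate each other.\<close>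
  have lh: "l i (h j) = 0" for i j
    using lG[of i "h j"] neq(1)[of i j] by (simp add: Gh l_lin)
  \<comment> \<open>Newton's basis: applying the factors G - \<mu> k to \<open>e\<close>, where
    every \<open>l i\<close> equals 1, gives products that vanish exactly for i < j.\<close>
  define x where "x = rec_nat e (\<lambda>j y. G y - \<mu> j *\<^sub>C y)"
  have lx: "l i (x j) = (\<Prod>k<j. \<mu> i - \<mu> k)" for i j
  proof (induction j)
    case 0
    then show ?case by (simp add: x_def l_def one)
  next
    case (Suc j)
    have "l i (x (Suc j)) = (\<mu> i - \<mu> j) * l i (x j)"
      by (simp add: x_def l_lin lG algebra_simps)
    with Suc show ?case by simp
  qed
  \<comment> \<open>The dual Newton basis: \<open>f\<close> equals 1 on every \<open>h j\<close> and
    is composed with the factors G - \<nu> k, which now vanish for j < i.\<close>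
  define g where "g = rec_nat ?f (\<lambda>i g y. g (G y - \<nu> i *\<^sub>C y))"
  have G_lin: "G (y + z) = G y + G z" "G (c *\<^sub>C y) = c *\<^sub>C G y" for y z c
    by (simp_all add: G_def F_def bounded_clinear_add[OF T] bounded_clinear_scaleC[OF T] f_lin scaleC_add_left
        cvec.scale_right_diff_distrib scaleC_scaleC)
  have cform_g: "cform (g i)" for i
  proof (induction i)
    case 0
    then show ?case by (simp add: g_def cform_complexify)
  next
    case (Suc i)
    have "g (Suc i) y = g i (G y - \<nu> i *\<^sub>C y)" for y by (simp add: g_def)
    moreover have "g i (y + z) = g i y + g i z" "g i (y - z) = g i y - g i z" "g i (c *\<^sub>C y) = c * g i y" for y z c
      using Suc cform_diff[OF Suc] by (simp_all add: cform_def)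
    ultimately show ?case unfolding cform_def
      by (simp add: G_lin scaleC_add_right cvec.scale_left_commute[of "\<nu> i"]) (simp add: algebra_simps)
  qed
  have gh: "g i (h j) = (\<Prod>k<i. \<nu> j - \<nu> k)" for i j
  proof (induction i)
    case 0
    then show ?case by (simp add: g_def h_def one)
  next
    case (Suc i)
    have "g (Suc i) (h j) = g i ((\<nu> j - \<nu> i) *\<^sub>C h j)"
      by (simp add: g_def Gh cvec.scale_left_diff_distrib)
    then show ?case using Suc cform_g[of i] by (simp add: cform_def)
  qed
  define L where "L = (\<Inter>i. {y. l i y = 0})"
  have "half_space L"
    unfolding half_space_def
  proof (intro conjI)
    show "csubspace L"
      unfolding L_def csubspace_eq_subspace
      by (intro cvec.subspace_Inter) (auto simp: subspace_cform_kernel cform_l)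
    show "closed L" unfolding L_def by (intro closed_INT ballI closed_cform_kernel blin_l)
    show "\<not> cfinite_dim L"
      by (rule triangular_not_cfinite_dim[of g h]) (auto simp: cform_g gh neq L_def lh)
    show "\<not> cfinite_codim L"
      by (rule triangular_not_cfinite_codim[of l x]) (auto simp: cform_l lx neq L_def)
  qed
  moreover have "(\<lambda>x. T x - F x) ` L \<subseteq> L"
    using lG by (auto simp: L_def G_def)
  ultimately show ?thesis using that by blast
qed

end

section \<open>Poles of the resolvent\<close>

lemma Baire_nonempty_interior:
  fixes C :: "nat \<Rightarrow> 'a::complete_space set"
  assumes "\<And>n. closed (C n)" "interior (\<Union>n. C n) \<noteq> {}"
  obtains n where "interior (C n) \<noteq> {}"
proof (rule ccontr)
  assume "\<not> thesis"
  with that have "interior (C n) = {}" for n by blast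
  then have "euclidean interior_of \<Union> (range C) = {}"
    using assms(1) by (intro Baire_category_alt) (auto simp: completely_metrizable_space_euclidean)
  with assms(2) show False by simp
qed

text \<open>Moving \<open>f\<close> moves \<open>f (A e)\<close> over a disc of radius proportional to \<open>norm (A e)\<close>, and moving \<open>e\<close>
  over a disc of radius proportional to the norm of \<open>f \<circ> A\<close>; both discs miss 1.\<close>

lemma operator_bound_if_avoids_one:
  fixes A :: "'a::cnormed_vector \<Rightarrow> 'a"
  assumes A: "bounded_clinear A" and d: "0 < d"
    and avoid: "\<And>e f. norm (e - e0) < d \<Longrightarrow> norm (f - f0) < d \<Longrightarrow> complexify f (A e) \<noteq> 1"
  shows "norm (A x) \<le> 6 / d\<^sup>2 * cmod (complexify f0 (A e0) - 1) * norm x"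
proof -
  define a where "a = complexify f0 (A e0) - 1"
  have lin: "complexify f0 (y + z) = complexify f0 y + complexify f0 z"
    "complexify f0 (c *\<^sub>C y) = c * complexify f0 y" for y z c
    using cform_complexify[of f0] by (simp_all add: cform_def)
  have 1: "d * norm (A e) \<le> cmod (complexify f0 (A e) - 1)" if e: "norm (e - e0) < d" for e
  proof (rule ccontr)
    define c where "c = 1 - complexify f0 (A e)"
    assume "\<not> ?thesis"
    then have c: "cmod c < d * norm (A e)" by (simp add: c_def norm_minus_commute)
    then have w: "A e \<noteq> 0" by auto
    obtain g where g: "norm g \<le> cmod c / norm (A e)" "complexify g (A e) = c"
      using complexify_attains[OF w] by blast
    have "cmod c / norm (A e) < d" using c w by (simp add: field_simps)
    with g avoid[OF e, of "f0 + g"] show False by (simp add: complexify_add_left c_def)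
  qed
  have 2: "d * cmod (complexify f0 (A u)) \<le> cmod a * norm u" for u
  proof (rule ccontr)
    assume n: "\<not> ?thesis"
    then have b: "complexify f0 (A u) \<noteq> 0" by auto
    define t where "t = - a / complexify f0 (A u)"
    have "norm (t *\<^sub>C u) < d" using n b by (simp add: norm_scaleC t_def norm_divide field_simps)
    then have "complexify f0 (A (e0 + t *\<^sub>C u)) \<noteq> 1" using d by (intro avoid) auto
    moreover have "complexify f0 (A (e0 + t *\<^sub>C u)) = 1"
      using b by (simp add: bounded_clinear_add[OF A] bounded_clinear_scaleC[OF A] lin) (simp add: t_def a_def)
    ultimately show False by blast
  qed
  \<comment> \<open>\<open>A u\<close> is the difference of the values at \<open>e0 + u\<close> and
    \<open>e0\<close>. Estimate 1 at these two points and estimate 2 for the change of the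
    right-hand side contribute cmod a each, whence the 3.\<close>
  have 3: "d * norm (A u) \<le> 3 * cmod a" if u: "norm u < d" for u
  proof -
    have "d * norm (A u) \<le> d * (norm (A (e0 + u)) + norm (A e0))"
      using norm_triangle_ineq4[of "A e0 + A u" "A e0"] d
      by (intro mult_left_mono) (auto simp: bounded_clinear_add[OF A])
    moreover have "d * norm (A (e0 + u)) \<le> cmod (a + complexify f0 (A u))"
      using 1[of "e0 + u"] u by (simp add: bounded_clinear_add[OF A] lin a_def algebra_simps)
    moreover have "cmod (a + complexify f0 (A u)) \<le> cmod a + cmod (complexify f0 (A u))"
      by (rule norm_triangle_ineq)
    moreover have "d * norm (A e0) \<le> cmod a" using 1[of e0] d by (simp add: a_def)
    moreover have "cmod (complexify f0 (A u)) \<le> cmod a"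
    proof -
      have "d * cmod (complexify f0 (A u)) \<le> cmod a * d"
        using 2[of u] u mult_left_mono[of "norm u" d "cmod a"] by simp
      with d show ?thesis by (simp add: mult.commute)
    qed
    ultimately show ?thesis by (simp add: algebra_simps)
  qed
  show ?thesis
  proof (cases "x = 0")
    case True
    then show ?thesis using bounded_clinear_diff[OF A, of 0 0] by simp
  next
    case False
    have sc: "A (r *\<^sub>R x) = r *\<^sub>R A x" for r using bounded_clinear_scaleC[OF A] by (simp add: scaleR_scaleC)
    \<comment> \<open>Rescaling \<open>x\<close> to norm d / 2, strictly inside the ball, doubles
      the 3 to the 6 of the statement.\<close>
    have "d * norm (A ((d / (2 * norm x)) *\<^sub>R x)) \<le> 3 * cmod a"
      using d False by (intro 3) simp
    then show ?thesis
      using d False by (simp add: sc a_def[symmetric] field_simps power2_eq_square)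
  qed
qed

context bounded_operator
begin

section \<open>Stability of solutions and Baire category\<close>

lemma holomorphic_on_complexify_R: "(\<lambda>\<mu>. complexify f (R \<mu> e)) holomorphic_on resolvent_set"
  using R_has_field_derivative[OF _ cform_complexify bounded_linear_complexify] open_resolvent_set
  by (meson field_differentiable_def holomorphic_onI field_differentiable_at_within)

text \<open>A Hurwitz argument: on a circle around the isolated solution, the distance of the value
  from 1 is at least \<open>m\<close>. A perturbation below m / 2 leaves the centre closer to 1 than
  the circle, and the minimum modulus principle yields a solution inside.\<close>

lemma solution_stable:
  assumes \<mu>: "\<mu> \<in> resolvent_set" "complexify f (R \<mu> e) = 1" and \<rho>: "0 < \<rho>"
    and fin: "finite {\<nu> \<in> resolvent_set. complexify f (R \<nu> e) = 1}"
  obtains d where "0 < d"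
    "\<And>e' f'. norm (e' - e) < d \<Longrightarrow> norm (f' - f) < d \<Longrightarrow>
      \<exists>\<nu>\<in>ball \<mu> \<rho> \<inter> resolvent_set. complexify f' (R \<nu> e') = 1"
proof -
  obtain r0 K where r0: "0 < r0" "cball \<mu> r0 \<subseteq> resolvent_set" and K: "0 < K"
    and R_le: "\<And>\<nu> x. \<nu> \<in> cball \<mu> r0 \<Longrightarrow> norm (R \<nu> x) \<le> K * norm x"
    using resolvent_locally_bounded[OF \<mu>(1)] by metis
  obtain s where s: "0 < s" "\<And>\<nu>. \<nu> \<in> resolvent_set \<Longrightarrow> complexify f (R \<nu> e) = 1 \<Longrightarrow> \<nu> \<noteq> \<mu> \<Longrightarrow> s \<le> dist \<mu> \<nu>"
    using finite_set_avoid[OF fin, of \<mu>] by blast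
  \<comment> \<open>Halving \<open>s\<close> keeps the closed disc free of other solutions, so there
    is none on its boundary circle.\<close>
  define r where "r = min r0 (min \<rho> (s / 2))"
  have r: "0 < r" "r \<le> r0" "r \<le> \<rho>" "r < s" using r0 \<rho> s by (auto simp: r_def)
  have sub: "cball \<mu> r \<subseteq> resolvent_set" using r0 r by (meson cball_subset_cball_iff dual_order.trans dist_self add_0 subset_cball)
  have cont: "continuous_on (cball \<mu> r) (\<lambda>\<nu>. complexify f (R \<nu> e))" for f e
    using holomorphic_on_complexify_R sub by (meson continuous_on_subset holomorphic_on_imp_continuous_on)
  have "\<exists>z\<in>sphere \<mu> r. \<forall>\<nu>\<in>sphere \<mu> r. cmod (complexify f (R z e) - 1) \<le> cmod (complexify f (R \<nu> e) - 1)"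
    using r by (intro continuous_attains_inf continuous_intros continuous_on_subset[OF cont]) auto
  then obtain z where z: "z \<in> sphere \<mu> r"
    "\<And>\<nu>. \<nu> \<in> sphere \<mu> r \<Longrightarrow> cmod (complexify f (R z e) - 1) \<le> cmod (complexify f (R \<nu> e) - 1)" by blast
  define m where "m = cmod (complexify f (R z e) - 1)"
  have "m \<noteq> 0"
  proof
    assume "m = 0"
    then have "s \<le> dist \<mu> z" using z r sub by (intro s(2)) (auto simp: m_def)
    with z r show False by simp
  qed
  then have m: "0 < m" by (simp add: m_def)
  \<comment> \<open>Changing both entries by at most \<open>d\<close> changes the value by at most B
    d. The 2 is the factor in \<open>norm_complexify_le\<close>; the 1 covers the growth of
    \<open>norm f'\<close>, as d <= 1.\<close>
  define B where "B = 2 * K * (norm f + 1 + norm e)"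
  have B: "0 < B" using K norm_ge_zero[of f] norm_ge_zero[of e] unfolding B_def by (intro mult_pos_pos) linarith+
  define d where "d = min 1 (m / (2 * B))"
  have d: "0 < d" "d \<le> 1" "B * d \<le> m / 2" using m B by (auto simp: d_def min_def field_simps)
  show ?thesis
  proof (rule that[OF d(1)])
    fix e' f' assume e': "norm (e' - e) < d" and f': "norm (f' - f) < d"
    have nf: "norm f' \<le> norm f + 1" using f' d norm_triangle_sub[of f' f] by simp
    have close: "cmod (complexify f' (R \<nu> e') - complexify f (R \<nu> e)) < m / 2" if "\<nu> \<in> cball \<mu> r" for \<nu>
    proof -
      have \<nu>: "\<nu> \<in> cball \<mu> r0" "\<nu> \<in> resolvent_set" using that r sub by auto
      have "complexify f' (R \<nu> e') - complexify f (R \<nu> e) =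
          complexify f' (R \<nu> (e' - e)) + complexify (f' - f) (R \<nu> e)"
        by (simp add: complexify_diff_left cform_diff[OF cform_complexify] bounded_clinear_diff[OF bounded_clinear_R[OF \<nu>(2)]])
      also have "cmod \<dots> \<le> 2 * norm f' * norm (R \<nu> (e' - e)) + 2 * norm (f' - f) * norm (R \<nu> e)"
        by (intro norm_triangle_mono norm_complexify_le)
      also have "\<dots> \<le> 2 * (norm f + 1) * (K * norm (e' - e)) + 2 * norm (f' - f) * (K * norm e)"
        using K by (intro add_mono mult_mono R_le \<nu> nf mult_left_mono) auto
      also have "\<dots> \<le> 2 * (norm f + 1) * (K * norm (e' - e)) + 2 * d * (K * norm e)"
        using K f' by (intro add_mono mult_right_mono) auto
      also have "\<dots> < 2 * (norm f + 1) * (K * d) + 2 * d * (K * norm e)"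
        using K e' by (intro add_strict_right_mono mult_strict_left_mono) (auto intro: add_nonneg_pos)
      also have "\<dots> = B * d" by (simp add: B_def algebra_simps)
      also have "\<dots> \<le> m / 2" by (rule d)
      finally show ?thesis .
    qed
    obtain \<nu> where \<nu>: "\<nu> \<in> ball \<mu> r" "complexify f' (R \<nu> e') - 1 = 0"
    proof (rule holomorphic_contract_to_zero)
      show "continuous_on (cball \<mu> r) (\<lambda>\<nu>. complexify f' (R \<nu> e') - 1)" by (intro continuous_intros cont)
      show "(\<lambda>\<nu>. complexify f' (R \<nu> e') - 1) holomorphic_on ball \<mu> r"
        using sub ball_subset_cball
        by (intro holomorphic_intros holomorphic_on_subset[OF holomorphic_on_complexify_R]) blast
      show "0 < r" by (rule r)
      show "cmod (complexify f' (R \<mu> e') - 1) < cmod (complexify f' (R y e') - 1)" if y: "cmod (\<mu> - y) = r" for y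
      proof -
        have "cmod (complexify f' (R \<mu> e') - 1) < m / 2" using close[of \<mu>] r \<mu> by simp
        moreover have "m \<le> cmod (complexify f (R y e) - 1)" using z y by (auto simp: m_def dist_norm)
        moreover have "cmod (complexify f' (R y e') - complexify f (R y e)) < m / 2"
          using close[of y] y by (auto simp: dist_norm)
        ultimately show ?thesis
          using norm_triangle_ineq4[of "complexify f' (R y e') - 1" "complexify f' (R y e') - complexify f (R y e)"]
          by simp
      qed
    qed
    then show "\<exists>\<nu>\<in>ball \<mu> \<rho> \<inter> resolvent_set. complexify f' (R \<nu> e') = 1"
      using r sub by (intro bexI[of _ \<nu>]) auto
  qed
qed

text \<open>\<open>C k\<close> collects the pairs without solutions within 1 / (k + 1) of
  \<open>l\<close>. Stability makes it closed; a pair in the ball lies in some \<open>C k\<close>,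
  since its finitely many solutions all differ from \<open>l\<close>.\<close>

lemma solution_free_ball:
  assumes \<eta>: "0 < \<eta>" and l: "l \<notin> resolvent_set"
    and fin: "\<And>e f. norm (e, f) \<le> \<eta> \<Longrightarrow> finite {\<nu> \<in> resolvent_set. complexify f (R \<nu> e) = 1}"
  obtains e0 f0 d r where "0 < d" "0 < r"
    "\<And>e f \<mu>. norm (e - e0) < d \<Longrightarrow> norm (f - f0) < d \<Longrightarrow> \<mu> \<in> resolvent_set \<inter> ball l r \<Longrightarrow> complexify f (R \<mu> e) \<noteq> 1"
proof -
  define C :: "nat \<Rightarrow> ('a \<times> ('a \<Rightarrow>\<^sub>L real)) set" where
    "C k = {p \<in> cball 0 \<eta>. \<forall>\<mu>\<in>resolvent_set \<inter> ball l (1 / Suc k). complexify (snd p) (R \<mu> (fst p)) \<noteq> 1}" for k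
  have closed: "closed (C k)" for k
  proof -
    have "\<exists>d>0. ball p d \<subseteq> - C k" if p: "p \<in> - C k" for p
    proof (cases "p \<in> cball 0 \<eta>")
      case False
      then have "p \<in> - cball 0 \<eta>" by simp
      then obtain d where "d > 0" "ball p d \<subseteq> - cball 0 \<eta>"
        by (rule openE[OF open_Compl[OF closed_cball]])
      then show ?thesis unfolding C_def by blast
    next
      case True
      then obtain \<mu> where \<mu>: "\<mu> \<in> resolvent_set" "\<mu> \<in> ball l (1 / Suc k)" "complexify (snd p) (R \<mu> (fst p)) = 1"
        using p by (auto simp: C_def)
      obtain \<rho> where \<rho>: "0 < \<rho>" "ball \<mu> \<rho> \<subseteq> ball l (1 / Suc k)" using \<mu>(2) openE[OF open_ball] by blast
      have "finite {\<nu> \<in> resolvent_set. complexify (snd p) (R \<nu> (fst p)) = 1}"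
        using True by (intro fin) simp
      from solution_stable[OF \<mu>(1,3) \<rho>(1) this] obtain d where d: "0 < d"
        "\<And>e' f'. norm (e' - fst p) < d \<Longrightarrow> norm (f' - snd p) < d \<Longrightarrow>
          \<exists>\<nu>\<in>ball \<mu> \<rho> \<inter> resolvent_set. complexify f' (R \<nu> e') = 1" by blast
      have "ball p d \<subseteq> - C k"
      proof
        fix q assume "q \<in> ball p d"
        then have "dist q p < d" by (simp add: dist_commute)
        then have "norm (fst q - fst p) < d" "norm (snd q - snd p) < d"
          using dist_fst_le[of q p] dist_snd_le[of q p] unfolding dist_norm by linarith+
        from d(2)[OF this] \<rho>(2) show "q \<in> - C k" unfolding C_def by blast
      qed
      with d show ?thesis by blast
    qed
    then show ?thesis unfolding closed_def open_contains_ball by blast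
  qed
  have "ball 0 \<eta> \<subseteq> (\<Union>k. C k)"
  proof
    fix p assume "p \<in> ball (0 :: 'a \<times> ('a \<Rightarrow>\<^sub>L real)) \<eta>"
    then have p: "norm p \<le> \<eta>" by simp
    then obtain s where s: "0 < s" "\<And>\<nu>. \<nu> \<in> resolvent_set \<Longrightarrow> complexify (snd p) (R \<nu> (fst p)) = 1 \<Longrightarrow> s \<le> dist l \<nu>"
      using finite_set_avoid[OF fin[of "fst p" "snd p"], of l] l by auto
    obtain k where "1 / real (Suc k) < s" using s(1) nat_approx_posE by blast
    then have "p \<in> C k" using p s(2) unfolding C_def by force
    then show "p \<in> (\<Union>k. C k)" by blast
  qed
  then have "ball 0 \<eta> \<subseteq> interior (\<Union>k. C k)" by (simp add: interior_maximal)
  then have "interior (\<Union>k. C k) \<noteq> {}" using \<eta> centre_in_ball by blast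
  then obtain k where "interior (C k) \<noteq> {}" using Baire_nonempty_interior[of C] closed by blast
  then obtain p \<delta> where p: "0 < \<delta>" "ball p \<delta> \<subseteq> C k" using mem_interior by blast
  show ?thesis
  proof (rule that[of "\<delta> / 2" "1 / Suc k" "fst p" "snd p"])
    fix e f \<mu> assume *: "norm (e - fst p) < \<delta> / 2" "norm (f - snd p) < \<delta> / 2" "\<mu> \<in> resolvent_set \<inter> ball l (1 / Suc k)"
    have "norm ((e, f) - p) \<le> norm (fst ((e, f) - p)) + norm (snd ((e, f) - p))"
      by (metis norm_Pair_le prod.collapse)
    then have "norm ((e, f) - p) < \<delta>" using * by (simp add: fst_diff snd_diff)
    then have "(e, f) \<in> C k" using p by (auto simp: dist_norm norm_minus_commute)
    with * show "complexify f (R \<mu> e) \<noteq> 1" by (auto simp: C_def)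
  qed (use p in auto)
qed

text \<open>With \<open>\<Phi> \<mu> = f0 (R \<mu> e0) - 1\<close>, the bound of the resolvent by \<open>\<Phi>\<close> forces \<open>1 / \<Phi>\<close> to be
  Lipschitz at the spectrum, so that its square, extended by 0 over the spectrum, is holomorphic;
  the order of its zero at \<open>l\<close> bounds the order of the pole of \<open>R\<close>.\<close>

lemma pole_if_finitely_many_solutions:
  assumes \<eta>: "0 < \<eta>" and l: "l \<notin> resolvent_set" "l \<in> closure resolvent_set"
    and fin: "\<And>e f. norm (e, f) \<le> \<eta> \<Longrightarrow> finite {\<nu> \<in> resolvent_set. complexify f (R \<nu> e) = 1}"
  obtains n r C where "0 < r" "ball l r - {l} \<subseteq> resolvent_set"
    "\<And>z x. z \<in> ball l r - {l} \<Longrightarrow> cmod (z - l) ^ n * norm (R z x) \<le> C * norm x"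
proof -
  obtain e0 f0 d r0 where d: "0 < d" and r0: "0 < r0"
    and avoid: "\<And>e f \<mu>. norm (e - e0) < d \<Longrightarrow> norm (f - f0) < d \<Longrightarrow> \<mu> \<in> resolvent_set \<inter> ball l r0 \<Longrightarrow>
      complexify f (R \<mu> e) \<noteq> 1"
    using solution_free_ball[OF \<eta> l(1) fin] by metis
  define C where "C = 6 / d\<^sup>2"
  have C: "0 < C" using d by (simp add: C_def)
  define \<Phi> where "\<Phi> \<mu> = complexify f0 (R \<mu> e0) - 1" for \<mu>
  have \<Phi>0: "\<Phi> \<mu> \<noteq> 0" if "\<mu> \<in> resolvent_set \<inter> ball l r0" for \<mu>
    using avoid[of e0 f0 \<mu>] that d by (simp add: \<Phi>_def)
  have R_le: "norm (R \<mu> x) \<le> C * cmod (\<Phi> \<mu>) * norm x" if "\<mu> \<in> resolvent_set \<inter> ball l r0" for \<mu> x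
    unfolding C_def \<Phi>_def
    using that by (intro operator_bound_if_avoids_one d avoid bounded_clinear_R) auto
  \<comment> \<open>By the Neumann series, no spectral point is closer to \<open>z\<close> than the
    reciprocal of a bound for \<open>R z\<close>.\<close>
  have lip: "cmod (1 / \<Phi> z) \<le> C * cmod (z - w)"
    if z: "z \<in> resolvent_set \<inter> ball l r0" and w: "w \<notin> resolvent_set" for z w
  proof -
    have "\<not> cmod (w - z) * (C * cmod (\<Phi> z)) < 1"
      using resolvent_set_perturb(1)[of z "C * cmod (\<Phi> z)" w] R_le[OF z] z w C \<Phi>0[OF z] by auto
    then show ?thesis using \<Phi>0[OF z] by (simp add: norm_divide field_simps norm_minus_commute)
  qed
  define H where "H z = (if z \<in> resolvent_set then (1 / \<Phi> z)\<^sup>2 else 0)" for z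
  have holH: "H holomorphic_on ball l r0"
  proof (rule holomorphic_onI)
    fix z assume z: "z \<in> ball l r0"
    have "H field_differentiable at z"
    proof (cases "z \<in> resolvent_set")
      case True
      have op: "open (resolvent_set \<inter> ball l r0)" by (intro open_Int open_resolvent_set open_ball)
      have "(\<lambda>z. (1 / \<Phi> z)\<^sup>2) holomorphic_on resolvent_set \<inter> ball l r0"
        using \<Phi>0 unfolding \<Phi>_def
        by (intro holomorphic_intros holomorphic_on_subset[OF holomorphic_on_complexify_R]) auto
      then have "H holomorphic_on resolvent_set \<inter> ball l r0"
        by (rule holomorphic_transform) (simp add: H_def)
      with op True z show ?thesis by (simp add: holomorphic_on_imp_differentiable_at)
    next
      case False
      have "((\<lambda>y. (H y - H z) / (y - z)) \<longlongrightarrow> 0) (at z)"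
      proof (rule Lim_null_comparison)
        have "\<forall>\<^sub>F y in at z. y \<in> ball l r0 - {z}" using z by (intro eventually_at_in_open) auto
        then show "\<forall>\<^sub>F y in at z. norm ((H y - H z) / (y - z)) \<le> C\<^sup>2 * cmod (y - z)"
        proof eventually_elim
          case (elim y)
          have "cmod (H y) \<le> (C * cmod (y - z))\<^sup>2"
            using lip[OF _ False, of y] elim
            by (cases "y \<in> resolvent_set") (auto simp: H_def norm_power intro!: power_mono)
          then show ?case using False elim
            by (simp add: H_def[of z] norm_divide field_simps power2_eq_square)
        qed
        show "((\<lambda>y. C\<^sup>2 * cmod (y - z)) \<longlongrightarrow> 0) (at z)" by (auto intro!: tendsto_eq_intros)
      qed
      then show ?thesis unfolding field_differentiable_def has_field_derivative_iff by blast
    qed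
    then show "H field_differentiable at z within ball l r0" by (rule field_differentiable_at_within)
  qed
  obtain w where w: "w \<in> resolvent_set" "w \<in> ball l r0"
    using l(2) r0 by (auto simp: closure_approachable dist_commute)
  have "H w \<noteq> H l" using w \<Phi>0[of w] l by (simp add: H_def)
  then obtain k n r where k: "0 < k" "0 < r" "ball l r \<subseteq> ball l r0"
    "\<And>z. z \<in> ball l r \<Longrightarrow> k * cmod (z - l) ^ n \<le> cmod (H z - H l)"
    using holomorphic_lower_bound_difference[OF holH open_ball connected_ball _ w(2), of l] r0
    by (metis centre_in_ball)
  \<comment> \<open>\<open>H\<close> vanishes at every spectral point of the disc, and the lower
    bound permits a zero at \<open>l\<close> only.\<close>
  have res: "z \<in> resolvent_set" if "z \<in> ball l r - {l}" for z
  proof (rule ccontr)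
    assume "z \<notin> resolvent_set"
    then have "k * cmod (z - l) ^ n \<le> 0" using k(4)[of z] that l(1) by (simp add: H_def)
    moreover have "0 < k * cmod (z - l) ^ n" using k that by simp
    ultimately show False by linarith
  qed
  \<comment> \<open>The bound on \<open>\<Phi>\<close> gives growth of order n / 2 with constant C /
    sqrt k; the radius is cut to 1 so that the integer exponent \<open>n\<close> serves as
    well.\<close>
  show ?thesis
  proof (rule that[of "min r 1" n "C / sqrt k"])
    show "ball l (min r 1) - {l} \<subseteq> resolvent_set" by (intro subsetI res) auto
    fix z x assume z: "z \<in> ball l (min r 1) - {l}"
    then have zr: "z \<in> resolvent_set \<inter> ball l r0" using res[of z] k(3) by auto
    have le1: "cmod (z - l) \<le> 1" using z by (simp add: dist_norm norm_minus_commute)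
    have "k * cmod (z - l) ^ n \<le> cmod (1 / \<Phi> z) ^ 2"
      using k(4)[of z] z zr l(1) by (simp add: H_def norm_power)
    then have *: "k * cmod (z - l) ^ n * cmod (\<Phi> z) ^ 2 \<le> 1"
      using \<Phi>0[OF zr] by (simp add: norm_divide field_simps)
    have "(cmod (z - l) ^ n * norm (R z x))\<^sup>2 = cmod (z - l) ^ n * (cmod (z - l) ^ n * norm (R z x) ^ 2)"
      by (simp add: power2_eq_square)
    also have "\<dots> \<le> 1 * (cmod (z - l) ^ n * norm (R z x) ^ 2)"
      using le1 by (intro mult_right_mono power_le_one) auto
    also have "\<dots> \<le> cmod (z - l) ^ n * (C * cmod (\<Phi> z) * norm x) ^ 2"
      using R_le[OF zr, of x] by (simp add: mult_left_mono power_mono)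
    also have "\<dots> = (k * cmod (z - l) ^ n * cmod (\<Phi> z) ^ 2) * ((C * norm x)\<^sup>2 / k)"
      using k by (simp add: power_mult_distrib)
    also have "\<dots> \<le> 1 * ((C * norm x)\<^sup>2 / k)" using k by (intro mult_right_mono *) auto
    also have "\<dots> = (C / sqrt k * norm x)\<^sup>2" using k by (simp add: power_mult_distrib power_divide)
    finally show "cmod (z - l) ^ n * norm (R z x) \<le> C / sqrt k * norm x"
      by (rule power2_le_imp_le) (use C k in simp)
  qed (use k in auto)
qed

end

section \<open>Operators with finitely many poles\<close>

text \<open>Riemann's removable singularity theorem, one point at a time; the extension agrees with
  \<open>f\<close> near the remaining points, so their bounds persist.\<close>

lemma entire_extension:
  assumes "finite S" "f holomorphic_on - S"
    and "\<And>l. l \<in> S \<Longrightarrow> \<exists>B. \<forall>\<^sub>F z in at l. cmod (f z) \<le> B"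
  shows "\<exists>g. g holomorphic_on UNIV \<and> (\<forall>z\<in>- S. g z = f z)"
  using assms
proof (induction S arbitrary: f rule: finite_induct)
  case empty
  then show ?case by auto
next
  case (insert a S)
  have eq: "- insert a S = - S - {a}" by auto
  have op: "open (- S)" using insert.hyps by (intro open_Compl finite_imp_closed)
  have "a \<in> interior (- S)" using insert.hyps op by (simp add: interior_open)
  then obtain g where g: "g holomorphic_on - S" "\<And>z. z \<in> - S - {a} \<Longrightarrow> g z = f z"
    using holomorphic_on_extend_bounded[of f "- S" a] insert.prems unfolding eq by blast
  have "\<exists>B. \<forall>\<^sub>F z in at l. cmod (g z) \<le> B" if l: "l \<in> S" for l
  proof -
    obtain B where "\<forall>\<^sub>F z in at l. cmod (f z) \<le> B" using insert.prems(2) l by blast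
    moreover have "\<forall>\<^sub>F z in at l. z \<in> - (insert a S - {l}) - {l}"
      using insert.hyps by (intro eventually_at_in_open open_Compl finite_imp_closed) auto
    ultimately have "\<forall>\<^sub>F z in at l. cmod (g z) \<le> B"
      by eventually_elim (use g(2) in auto)
    then show ?thesis by blast
  qed
  with insert.IH[OF g(1)] obtain h where "h holomorphic_on UNIV" "\<And>z. z \<in> - S \<Longrightarrow> h z = g z" by blast
  with g(2) show ?case by (intro exI[of _ h]) auto
qed

context bounded_operator
begin

section \<open>Finiteness of the spectrum\<close>

lemma resolvent_set_nonempty: "resolvent_set \<noteq> {}"
proof -
  obtain B where B: "0 < B" "\<And>\<mu>. B < cmod \<mu> \<Longrightarrow> \<mu> \<in> resolvent_set" using resolvent_set_large by metis
  have "B < cmod (of_real (B + 1))" using B(1) by (simp del: of_real_add)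
  with B(2) show ?thesis by blast
qed

text \<open>A limit point of the spectrum cannot lie in the closure of the resolvent set, so it is
  interior to the spectrum. Hence the interior is open and closed, and empty because the resolvent
  set is not; a compact set without limit points remains.\<close>

lemma finite_spectrum:
  assumes iso: "\<And>l. l \<notin> resolvent_set \<Longrightarrow> l \<in> closure resolvent_set \<Longrightarrow> \<exists>r>0. ball l r - {l} \<subseteq> resolvent_set"
  shows "finite (- resolvent_set)" "closure resolvent_set = UNIV"
proof -
  let ?S = "- resolvent_set"
  have closed: "closed ?S" using open_resolvent_set by (simp add: closed_def)
  obtain B where "\<And>\<mu>. B < cmod \<mu> \<Longrightarrow> \<mu> \<in> resolvent_set" using resolvent_set_large by metis
  then have "?S \<subseteq> cball 0 B" by force
  then have "compact ?S" using closed bounded_subset[OF bounded_cball] by (simp add: compact_eq_bounded_closed)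
  have nolim: "\<not> l islimpt ?S" if l: "l \<in> closure resolvent_set" for l
  proof
    assume lim: "l islimpt ?S"
    then have "l \<notin> resolvent_set" using closed closed_limpt by blast
    then obtain r where "0 < r" "ball l r - {l} \<subseteq> resolvent_set" using iso l by blast
    then obtain z where "z \<in> ?S" "z \<in> ball l r" "z \<noteq> l"
      using islimptE[OF lim, of "ball l r"] by auto
    with \<open>ball l r - {l} \<subseteq> resolvent_set\<close> show False by blast
  qed
  have "closed (interior ?S)"
    unfolding closed_limpt
  proof (intro allI impI)
    fix l assume "l islimpt interior ?S"
    then have "l islimpt ?S" using interior_subset islimpt_subset by blast
    then have "l \<notin> closure resolvent_set" using nolim by blast
    then show "l \<in> interior ?S" by (simp add: interior_complement)
  qed
  then have "interior ?S = {} \<or> interior ?S = UNIV" by (intro clopen[THEN iffD1]) simp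
  then show cl: "closure resolvent_set = UNIV"
    using resolvent_set_nonempty closure_subset[of resolvent_set] unfolding interior_complement by blast
  show "finite ?S"
    using finite_not_islimpt_in_compact[OF \<open>compact ?S\<close>, of ?S] nolim cl by simp
qed

section \<open>Polynomials in \<open>T\<close>, written as \<open>fold shift ls\<close> with the
  list \<open>ls\<close> of roots\<close>

lemma shift_commute: "shift a (shift b x) = shift b (shift a x)"
  by (simp add: shift_def bounded_clinear_diff[OF T] bounded_clinear_scaleC[OF T] cvec.scale_right_diff_distrib
      scaleC_scaleC mult.commute)

lemma R_shift_commute:
  assumes m: "\<mu> \<in> resolvent_set" shows "R \<mu> (shift a x) = shift a (R \<mu> x)"
  by (rule R_unique[OF m]) (simp add: shift_commute[of \<mu>] shift_R[OF m])

lemma R_fold_commute: "\<mu> \<in> resolvent_set \<Longrightarrow> fold shift ls (R \<mu> x) = R \<mu> (fold shift ls x)"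
  by (induction ls arbitrary: x) (simp_all add: R_shift_commute[symmetric])

lemma bounded_clinear_fold_shift: "bounded_clinear (fold shift ls)"
proof (induction ls)
  case Nil
  show ?case by (intro bounded_clinearI[where K = 1]) simp_all
next
  case (Cons l ls)
  then show ?case using bounded_clinear_compose[OF Cons bounded_clinear_shift[of l]] by (simp add: comp_def)
qed

lemma fold_shift_replicate: "fold shift (replicate n l) x = (shift l ^^ n) x"
  by (induction n arbitrary: x) (simp_all add: funpow_swap1)

lemma bounded_clinear_shift_power: "bounded_clinear (shift l ^^ n)"
  using bounded_clinear_fold_shift[of "replicate n l"] fold_shift_replicate[of n l]
  by (simp add: fun_eq_iff[symmetric])

text \<open>Since shift l (R z x) = x + (z - l) R z x, each application of \<open>shift l\<close>
  trades one power of z - l for a bounded term.\<close>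

lemma pole_cancelled_by_power:
  assumes res: "ball l r - {l} \<subseteq> resolvent_set"
    and pole: "\<And>z x. z \<in> ball l r - {l} \<Longrightarrow> cmod (z - l) ^ n * norm (R z x) \<le> C * norm x"
  shows "\<exists>M. \<forall>z\<in>ball l r - {l}. norm ((shift l ^^ n) (R z x)) \<le> M"
proof -
  have "\<exists>M. \<forall>z\<in>ball l r - {l}. cmod (z - l) ^ (n - j) * norm ((shift l ^^ j) (R z x)) \<le> M" if "j \<le> n" for j
    using that
  proof (induction j)
    case 0
    show ?case by (rule exI[of _ "C * norm x"]) (use pole in auto)
  next
    case (Suc j)
    then obtain M where M: "\<And>z. z \<in> ball l r - {l} \<Longrightarrow> cmod (z - l) ^ (n - j) * norm ((shift l ^^ j) (R z x)) \<le> M"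
      by (metis Suc_leD)
    have nj: "n - j = Suc (n - Suc j)" using Suc.prems by simp
    show ?case
    proof (intro exI ballI)
      fix z assume z: "z \<in> ball l r - {l}"
      then have zr: "z \<in> resolvent_set" using res by blast
      let ?d = "cmod (z - l)"
      have d: "?d \<le> r" using z by (simp add: dist_norm norm_minus_commute)
      have "shift l (R z x) = x + (z - l) *\<^sub>C R z x"
        using shift_eq[of l "R z x" z] shift_R[OF zr] by simp
      then have "(shift l ^^ Suc j) (R z x) = (shift l ^^ j) x + (z - l) *\<^sub>C (shift l ^^ j) (R z x)"
        by (simp add: funpow_Suc_right bounded_clinear_add[OF bounded_clinear_shift_power]
            bounded_clinear_scaleC[OF bounded_clinear_shift_power] del: funpow.simps)
      then have "norm ((shift l ^^ Suc j) (R z x)) \<le> norm ((shift l ^^ j) x) + ?d * norm ((shift l ^^ j) (R z x))"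
        using norm_triangle_ineq[of "(shift l ^^ j) x" "(z - l) *\<^sub>C (shift l ^^ j) (R z x)"] by (simp add: norm_scaleC)
      then have "?d ^ (n - Suc j) * norm ((shift l ^^ Suc j) (R z x)) \<le>
          ?d ^ (n - Suc j) * (norm ((shift l ^^ j) x) + ?d * norm ((shift l ^^ j) (R z x)))"
        by (intro mult_left_mono) auto
      also have "\<dots> = ?d ^ (n - Suc j) * norm ((shift l ^^ j) x) + ?d ^ (n - j) * norm ((shift l ^^ j) (R z x))"
        unfolding nj by (simp add: algebra_simps)
      also have "\<dots> \<le> r ^ (n - Suc j) * norm ((shift l ^^ j) x) + M"
        using d by (intro add_mono M z mult_right_mono power_mono) auto
      finally show "?d ^ (n - Suc j) * norm ((shift l ^^ Suc j) (R z x)) \<le> r ^ (n - Suc j) * norm ((shift l ^^ j) x) + M" .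
    qed
  qed
  from this[of n] show ?thesis by simp
qed

text \<open>Multiplying the resolvent by a polynomial in \<open>T\<close> that cancels the finitely many poles makes
  it entire; it vanishes at infinity, so by Liouville's theorem it is 0, and so is the polynomial.\<close>

lemma algebraic_if_poles:
  assumes fin: "finite (- resolvent_set)"
    and poles: "\<And>l. l \<notin> resolvent_set \<Longrightarrow> \<exists>n r C. 0 < r \<and> ball l r - {l} \<subseteq> resolvent_set \<and>
      (\<forall>z\<in>ball l r - {l}. \<forall>x. cmod (z - l) ^ n * norm (R z x) \<le> C * norm x)"
  obtains ls where "\<And>x. fold shift ls x = 0"
proof -
  have "\<exists>n. l \<notin> resolvent_set \<longrightarrow> (\<exists>r C. 0 < r \<and> ball l r - {l} \<subseteq> resolvent_set \<and>
      (\<forall>z\<in>ball l r - {l}. \<forall>x. cmod (z - l) ^ n * norm (R z x) \<le> C * norm x))" for l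
    using poles by blast
  then obtain n where n: "\<And>l. l \<notin> resolvent_set \<Longrightarrow> \<exists>r C. 0 < r \<and> ball l r - {l} \<subseteq> resolvent_set \<and>
      (\<forall>z\<in>ball l r - {l}. \<forall>x. cmod (z - l) ^ n l * norm (R z x) \<le> C * norm x)" by metis
  obtain xs where xs: "set xs = - resolvent_set" using finite_list[OF fin] by blast
  define ls where "ls = concat (map (\<lambda>l. replicate (n l) l) xs)"
  have bdd: "\<exists>M. \<forall>\<^sub>F z in at l. norm (fold shift ls (R z x)) \<le> M" if l: "l \<notin> resolvent_set" for l x
  proof -
    \<comment> \<open>The factors before \<open>l\<close> move past the resolvent onto
      \<open>x\<close>, those after it form one bounded operator; the \<open>n l\<close> copies of
      \<open>l\<close> between them cancel the pole.\<close>
    obtain as bs where "xs = as @ l # bs" using split_list[of l xs] l xs by auto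
    then obtain A B where AB: "ls = A @ replicate (n l) l @ B" by (auto simp: ls_def)
    obtain r C where r: "0 < r" "ball l r - {l} \<subseteq> resolvent_set"
      "\<And>z x. z \<in> ball l r - {l} \<Longrightarrow> cmod (z - l) ^ n l * norm (R z x) \<le> C * norm x" using n[OF l] by metis
    obtain M where M: "\<And>z. z \<in> ball l r - {l} \<Longrightarrow> norm ((shift l ^^ n l) (R z (fold shift A x))) \<le> M"
      using pole_cancelled_by_power[OF r(2,3)] by metis
    obtain D where D: "0 < D" "\<And>y. norm (fold shift B y) \<le> norm y * D"
      using bounded_linear.pos_bounded[OF bounded_clinear_imp_bounded_linear[OF bounded_clinear_fold_shift]] by blast
    have "\<forall>\<^sub>F z in at l. z \<in> ball l r - {l}" using r by (intro eventually_at_in_open) auto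
    then have "\<forall>\<^sub>F z in at l. norm (fold shift ls (R z x)) \<le> M * D"
    proof eventually_elim
      case (elim z)
      then have "fold shift ls (R z x) = fold shift B ((shift l ^^ n l) (R z (fold shift A x)))"
        using r(2) by (auto simp: AB fold_shift_replicate R_fold_commute[of z A])
      also have "norm \<dots> \<le> norm ((shift l ^^ n l) (R z (fold shift A x))) * D" by (rule D)
      also have "\<dots> \<le> M * D" using D(1) M[OF elim] by simp
      finally show ?case .
    qed
    then show ?thesis by blast
  qed
  obtain B where B: "0 < B" "\<And>\<mu>. B < cmod \<mu> \<Longrightarrow> \<mu> \<in> resolvent_set"
    "\<And>\<mu> x. B < cmod \<mu> \<Longrightarrow> (cmod \<mu> - B) * norm (R \<mu> x) \<le> norm x" using resolvent_set_large by blast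
  have "fold shift ls x = 0" for x
  proof -
    \<comment> \<open>\<open>R z y\<close> is the polynomial applied to \<open>R z x\<close>, hence
      bounded near every pole.\<close>
    define y where "y = fold shift ls x"
    have zero: "complexify f (R z y) = 0" if z: "z \<in> resolvent_set" for f z
    proof -
      have "\<exists>M. \<forall>\<^sub>F z in at l. cmod (complexify f (R z y)) \<le> M" if l: "l \<in> - resolvent_set" for l
      proof -
        obtain M where "\<forall>\<^sub>F z in at l. norm (fold shift ls (R z x)) \<le> M" using bdd l by blast
        moreover have "\<forall>\<^sub>F z in at l. z \<in> resolvent_set"
          using poles[of l] l eventually_at_in_open[of "ball l _" l]
          by (metis (mono_tags, lifting) ComplD centre_in_ball eventually_mono open_ball subsetD)
        ultimately have "\<forall>\<^sub>F z in at l. cmod (complexify f (R z y)) \<le> 2 * norm f * M"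
        proof eventually_elim
          case (elim z)
          then have "norm (R z y) \<le> M" by (simp add: y_def R_fold_commute)
          then have "2 * norm f * norm (R z y) \<le> 2 * norm f * M" by (intro mult_left_mono) auto
          with norm_complexify_le[of f "R z y"] show ?case by linarith
        qed
        then show ?thesis by blast
      qed
      then obtain g where g: "g holomorphic_on UNIV" "\<And>z. z \<in> resolvent_set \<Longrightarrow> g z = complexify f (R z y)"
        using entire_extension[OF fin, of "\<lambda>z. complexify f (R z y)"] holomorphic_on_complexify_R by auto
      have "(g \<longlongrightarrow> 0) at_infinity"
      proof (rule Lim_null_comparison)
        have "\<forall>\<^sub>F z in at_infinity. B + 1 \<le> cmod z" by (auto simp: eventually_at_infinity)
        then show "\<forall>\<^sub>F z in at_infinity. cmod (g z) \<le> (2 * norm f * norm y) / (- B + cmod z)"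
        proof eventually_elim
          case (elim z)
          then have z: "B < cmod z" by simp
          have "norm (R z y) \<le> norm y / (- B + cmod z)" using B(3)[OF z, of y] z by (simp add: field_simps)
          then have "2 * norm f * norm (R z y) \<le> 2 * norm f * (norm y / (- B + cmod z))" by (intro mult_left_mono) auto
          with norm_complexify_le[of f "R z y"] show ?case using g(2)[OF B(2)[OF z]] by simp
        qed
        show "((\<lambda>z. (2 * norm f * norm y) / (- B + cmod z)) \<longlongrightarrow> 0) at_infinity"
          by (intro real_tendsto_divide_at_top[OF tendsto_const] filterlim_tendsto_add_at_top[OF tendsto_const]
              filterlim_norm_at_top)
      qed
      then have "g z = 0" by (rule Liouville_weak_0[OF g(1)])
      with g(2)[OF z] show ?thesis by simp
    qed
    obtain z where z: "z \<in> resolvent_set" using resolvent_set_nonempty by blast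
    have "R z y = 0" using complexify_separates zero[OF z] by blast
    then have "y = shift z 0" using shift_R[OF z] by metis
    then show ?thesis using bounded_clinear_diff[OF bounded_clinear_shift, of z 0 0] by (simp add: y_def)
  qed
  with that show ?thesis by blast
qed

text \<open>If the first factor has a finite-dimensional kernel, its image of \<open>M\<close> is
  still infinite-dimensional and is killed by the remaining factors. This cannot go on to the empty
  product, the identity.\<close>

lemma infinite_dim_eigenspace:
  assumes "\<And>x. x \<in> M \<Longrightarrow> fold shift ls x = 0" "csubspace M" "\<not> cfinite_dim M"
  obtains l where "\<not> cfinite_dim {x. shift l x = 0}"
  using assms
proof (induction ls arbitrary: M thesis)
  case Nil
  then show ?case using not_cfinite_dim_nonzero by fastforce
next
  case (Cons l ls)
  show ?case
  proof (cases "cfinite_dim {x. shift l x = 0}")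
    case True
    have lin: "clinear (shift l)" using bounded_clinear_shift by (simp add: bounded_clinear_def)
    show ?thesis
    proof (rule Cons.IH)
      show "\<And>x. x \<in> shift l ` M \<Longrightarrow> fold shift ls x = 0" using Cons.prems(2) by auto
      show "\<not> cfinite_dim (shift l ` M)"
        using cfinite_dim_kernel_image[OF lin Cons.prems(3) True] Cons.prems(4) by blast
      show "csubspace (shift l ` M)"
        using Cons.prems(3) lin unfolding csubspace_def clinear_def
        by (auto simp: image_iff) (metis cvec.scale_zero_left, metis, metis)
    qed (use Cons.prems in blast)
  qed (use Cons.prems in blast)
qed

text \<open>\<open>T\<close> is a scalar on the eigenspace, so every subspace of it is invariant and
  any half-space inside will do.\<close>

lemma eigenspace_half_space:
  assumes "\<not> cfinite_dim {x. shift l x = 0}"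
  obtains L where "half_space L" "T ` L \<subseteq> L"
proof -
  have sub: "csubspace {x. shift l x = 0}"
    using bounded_clinear_shift[of l] bounded_clinear_diff[OF bounded_clinear_shift, of l 0 0]
    by (simp add: csubspace_def bounded_clinear_add bounded_clinear_scaleC)
  have "closed {x. shift l x = 0}"
    by (intro closed_Collect_eq continuous_intros linear_continuous_on bounded_clinear_imp_bounded_linear bounded_clinear_shift)
  then obtain L where L: "half_space L" "L \<subseteq> {x. shift l x = 0}"
    using half_space_within[OF assms sub] by blast
  have "T x \<in> L" if "x \<in> L" for x
  proof -
    have "T x = l *\<^sub>C x" using L(2) that by (auto simp: shift_def)
    with L(1) that show ?thesis by (simp add: half_space_def csubspace_def)
  qed
  with L that show ?thesis by blast
qed

end

section \<open>The main theorem\<close>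

theorem mainTheorem1:
  fixes T :: "'a::cbanach \<Rightarrow> 'a" and \<epsilon> :: real
  assumes "\<not> cfinite_dim (UNIV :: 'a set)"
    and "bounded_clinear T"
    and "\<epsilon> > 0"
  shows "\<exists>F L. bounded_clinear F \<and> rank_le_one F \<and> onorm F < \<epsilon> \<and>
           half_space L \<and> (\<lambda>x. T x - F x) ` L \<subseteq> L"
proof -
  interpret bounded_operator T by unfold_locales fact
  \<comment> \<open>The norm of the rank-one operator is at most 2 (norm f) (norm e); bounding one
    factor by 1 and the other by \<epsilon> / 4 leaves \<epsilon> / 2, strictly below
    \<epsilon>.\<close>
  define \<eta> where "\<eta> = min 1 (\<epsilon> / 4)"
  have \<eta>: "0 < \<eta>" "\<eta> \<le> 1" "\<eta> \<le> \<epsilon> / 4" using assms(3) by (auto simp: \<eta>_def)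
  show ?thesis
  proof (cases "\<exists>e f. norm (e, f) \<le> \<eta> \<and> infinite {\<mu> \<in> resolvent_set. complexify f (R \<mu> e) = 1}")
    case True
    then obtain e f where ef: "norm (e, f) \<le> \<eta>" and inf: "infinite {\<mu> \<in> resolvent_set. complexify f (R \<mu> e) = 1}"
      by blast
    let ?F = "\<lambda>x. complexify f x *\<^sub>C e"
    have le: "norm f \<le> \<eta>" "norm e \<le> \<eta>"
      using order_trans[OF norm_fst_le ef] order_trans[OF norm_snd_le ef] by auto
    have bound: "norm (?F x) \<le> \<epsilon> / 2 * norm x" for x
    proof -
      have "norm (?F x) \<le> (2 * norm f * norm x) * norm e"
        unfolding norm_scaleC by (intro mult_right_mono norm_complexify_le) auto
      also have "\<dots> = 2 * (norm f * norm e) * norm x" by simp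
      also have "\<dots> \<le> 2 * (1 * (\<epsilon> / 4)) * norm x"
        using le \<eta> by (intro mult_right_mono mult_left_mono mult_mono) auto
      finally show ?thesis by simp
    qed
    have "onorm ?F \<le> \<epsilon> / 2" using assms(3) bound by (intro onorm_bound) auto
    then have "onorm ?F < \<epsilon>" using assms(3) by simp
    moreover have "bounded_clinear ?F"
      using cform_complexify[of f] bound
      by (intro bounded_clinearI[where K = "\<epsilon> / 2"]) (simp_all add: cform_def scaleC_add_left scaleC_scaleC mult.commute)
    moreover have "rank_le_one ?F"
      unfolding rank_le_one_def cspan_eq_span
      by (intro exI[of _ e]) (auto intro: cvec.span_scale cvec.span_base)
    moreover obtain L where "half_space L" "(\<lambda>x. T x - ?F x) ` L \<subseteq> L"
      using half_space_if_infinitely_many_solutions[OF inf] by blast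
    ultimately show ?thesis by blast
  next
    case False
    then have fin: "finite {\<mu> \<in> resolvent_set. complexify f (R \<mu> e) = 1}" if "norm (e, f) \<le> \<eta>" for e f
      using that by blast
    have pole: "\<exists>n r C. 0 < r \<and> ball l r - {l} \<subseteq> resolvent_set \<and>
      (\<forall>z\<in>ball l r - {l}. \<forall>x. cmod (z - l) ^ n * norm (R z x) \<le> C * norm x)"
      if l: "l \<notin> resolvent_set" "l \<in> closure resolvent_set" for l
      by (rule pole_if_finitely_many_solutions[OF \<eta>(1) l fin]) blast+
    have spec: "finite (- resolvent_set)" "closure resolvent_set = UNIV"
      using finite_spectrum pole by blast+
    \<comment> \<open>Density of the resolvent set discharges the closure condition in
      \<open>pole\<close>, so the estimate holds at every spectral point.\<close>
    obtain ls where "\<And>x. fold shift ls x = 0"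
      using algebraic_if_poles[OF spec(1) pole] spec(2) by blast
    then obtain l where "\<not> cfinite_dim {x. shift l x = 0}"
      using infinite_dim_eigenspace[of UNIV ls] assms(1) by (auto simp: csubspace_def)
    then obtain L where "half_space L" "T ` L \<subseteq> L" by (rule eigenspace_half_space)
    moreover have "bounded_clinear (\<lambda>x::'a. 0::'a)" by (rule bounded_clinearI[where K = 0]) simp_all
    moreover have "rank_le_one (\<lambda>x::'a. 0::'a)"
      unfolding rank_le_one_def cspan_eq_span by (intro exI[of _ 0]) auto
    moreover have "onorm (\<lambda>x::'a. 0::'a) < \<epsilon>" using assms(3) by (simp add: onorm_zero)
    ultimately show ?thesis by (intro exI[of _ "\<lambda>_. 0"] exI[of _ L]) simp
  qed
qed

end
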